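(* Let $\Delta$ be a saturated, contradiction-free first-order unification context and let $\Gamma=\mathrm{unif}(\Delta)$ (for any choice of resolutions and representatives in its construction). Then $\Gamma$ is a unifier of $\Delta$, and moreover $\Gamma$ is a most general unifier of $\Delta$.
   Context: Fix constructors $c,d,e$ (with arities), unification metavariables tagged contractive ($H^{\mathrm{con}}$) or recursive ($H^{\mathrm{rec}}$), and recursion constants $\underline r,\underline s,\underline t$. Contractive terms $U ::= c\,N_1\cdots N_n\mid H^{\mathrm{con}}$; recursive terms $N ::= \underline r\mid H^{\mathrm{rec}}$; $M$ denotes either. A unification context $\Delta$ is a finite collection of equations $U_1\doteq U_2$, equations $N_1\doteq N_2$, recursive definitions $\underline r=_dU$ (at most one per constant, all constants used being defined), and possibly the symbol $\mathrm{contra}$; contradiction-free if $\mathrm{contra}\notin\Delta$. $\mathrm{defs}(\Delta)$, $\mathrm{eqs}(\Delta)$, $UV(\Delta)$: definitions, equations, metavariables. Expansion: $\mathrm{exp}^\Delta_0(M)=\bot$; $\mathrm{exp}^\Delta_{k+1}(H^m)=H^m$; $\mathrm{exp}^\Delta_{k+1}(c\,N_1\cdots N_n)=c\,(\mathrm{exp}^\Delta_k(N_1))\cdots(\mathrm{exp}^\Delta_k(N_n))$; $\mathrm{exp}^\Delta_{k+1}(\underline r)=\mathrm{exp}^\Delta_{k+1}(U)$ for $\underline r=_dU\in\Delta$. $M\doteq M'$ holds in $\Delta$ if $\mathrm{exp}^\Delta_k(M)=\mathrm{exp}^\Delta_k(M')$ for all $k$. Substitutions: a contradiction-free context $\Gamma$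 whose equations have the form $H^{\mathrm{con}}\doteq U$ or $H^{\mathrm{rec}}\doteq N$, each metavariable on a left side at most once (its value); $\mathrm{dom}(\Gamma)$ the left-side metavariables. $M[\Gamma]$ replaces each $H^m\in\mathrm{dom}(\Gamma)$ by its value (constructors and recursion constants unchanged). $\Delta[\Gamma]=\mathrm{defs}(\Gamma)\cup\{M[\Gamma]\doteq M'[\Gamma]\}_{M\doteq M'\in\mathrm{eqs}(\Delta)}\cup\{\underline r=_dU[\Gamma]\}_{\underline r=_dU\in\mathrm{defs}(\Delta)}$; $\Gamma_1[\Gamma_2]=\mathrm{defs}(\Gamma_2)\cup\{H^m\doteq M[\Gamma_2]\}_{H^m\doteq M\in\mathrm{eqs}(\Gamma_1)}\cup\{\underline r=_dU[\Gamma_2]\}_{\underline r=_dU\in\mathrm{defs}(\Gamma_1)}$; $\Gamma_1\circ\Gamma_2=\Gamma_1[\Gamma_2]\cup\{H^m\doteq M\in\mathrm{eqs}(\Gamma_2)\mid H^m\notin\mathrm{dom}(\Gamma_1)\}$ (recursion constants always renamed apart as needed). $\Gamma=\Gamma'$ if $\mathrm{dom}(\Gamma)=\mathrm{dom}(\Gamma')$ and for each $H^m$ in it, $\mathrm{exp}^\Gamma_k(H^m[\Gamma])=\mathrm{exp}^{\Gamma'}_k(H^m[\Gamma'])$ for all $k$. A unifier of contradiction-free $\Delta$ is a substitution $\Gamma$ with $\mathrm{dom}(\Gamma)=UV(\Delta)$ such that every equation of $\Delta[\Gamma]$ holds in $\Delta[\Gamma]$. $\Gamma_1$ is more general than $\Gamma_2$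 if $\Gamma_1\circ\Gamma'=\Gamma_2$ for some substitution $\Gamma'$; a most general unifier is a unifier more general than every unifier. Saturation rules: SIMP-F: $c\,\overline N\doteq d\,\overline{N'}$, $c\ne d\Rightarrow\mathrm{contra}$; SIMP: $c\,N_1\cdots N_n\doteq c\,N'_1\cdots N'_n\Rightarrow N_i\doteq N'_i$ for all $i$; R-EXP: $\underline r\doteq\underline s$, $\underline r=_dU_1$, $\underline s=_dU_2\Rightarrow U_1\doteq U_2$; symmetry and transitivity of $\doteq$ on contractive terms and on recursive terms. $\Delta$ is saturated if every conclusion of a rule whose premises lie in $\Delta$ already lies in $\Delta$. Construction of $\mathrm{unif}(\Delta)$: $H^{\mathrm{con}}$ is resolved if $\Delta$ contains $H^{\mathrm{con}}\doteq c\,N_1\cdots N_n$ or its symmetric form (the right side is a resolution); $H^{\mathrm{rec}}$ is resolved if $\Delta$ contains $H^{\mathrm{rec}}\doteq\underline r$ or its symmetric form. Choose one resolution for each resolved metavariable. Unresolved metavariables form equivalence classes under the equations of $\Delta$ between them; choose a representative for each class. Then: (1) start with $\Gamma$ containing all recursive definitions of $\Delta$; (2) for each resolved $H^m\in UV(\Delta)$ add $H^m\doteq$ (its resolution); (3) for each unresolved $H^m\in UV(\Delta)$ add $H^m\doteq$ (its class representative); (4) in right-hand sides and definition bodies of $\Gamma$ repeatedly replace resolved metavariables by their resolutions and unresolved ones by their representatives until only representatives remain. *)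

theory Defs
  imports "HOL-Library.While_Combinator"
begin

text \<open>
  Types: \<open>'c\<close> constructors, \<open>'h\<close> metavariable names, \<open>'r\<close> recursion constants. Contractive and
  recursive metavariables with the same name are different metavariables.
\<close>

datatype 'h mvar = HCon 'h | HRec 'h

datatype ('h, rconsts_rtm: 'r) rtm = RConst 'r | RMeta 'h

datatype ('c, 'h, rconsts_ctm: 'r) ctm = Con 'c "('h, 'r) rtm list" | CMeta 'h

text \<open>Equations are oriented; the symmetric form of an equation is a different item.\<close>

datatype ('c, 'h, rconsts_item: 'r) item =
    CEq "('c, 'h, 'r) ctm" "('c, 'h, 'r) ctm"
  | REq "('h, 'r) rtm" "('h, 'r) rtm"
  | Def 'r "('c, 'h, 'r) ctm"
  | Contra

type_synonym ('c, 'h, 'r) ctx = "('c, 'h, 'r) item set"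

primrec uv_rtm :: "('h, 'r) rtm \<Rightarrow> 'h mvar set" where
  "uv_rtm (RConst r) = {}"
| "uv_rtm (RMeta H) = {HRec H}"

primrec uv_ctm :: "('c, 'h, 'r) ctm \<Rightarrow> 'h mvar set" where
  "uv_ctm (Con c Ns) = (\<Union>N\<in>set Ns. uv_rtm N)"
| "uv_ctm (CMeta H) = {HCon H}"

primrec uv_item :: "('c, 'h, 'r) item \<Rightarrow> 'h mvar set" where
  "uv_item (CEq U U') = uv_ctm U \<union> uv_ctm U'"
| "uv_item (REq N N') = uv_rtm N \<union> uv_rtm N'"
| "uv_item (Def r U) = uv_ctm U"
| "uv_item Contra = {}"

definition UV :: "('c, 'h, 'r) ctx \<Rightarrow> 'h mvar set" where
  "UV \<Delta> = (\<Union>i\<in>\<Delta>. uv_item i)"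

definition defs :: "('c, 'h, 'r) ctx \<Rightarrow> ('c, 'h, 'r) ctx" where
  "defs \<Delta> = {Def r U | r U. Def r U \<in> \<Delta>}"

primrec arity_ctm :: "('c \<Rightarrow> nat) \<Rightarrow> ('c, 'h, 'r) ctm \<Rightarrow> bool" where
  "arity_ctm ar (Con c Ns) \<longleftrightarrow> length Ns = ar c"
| "arity_ctm ar (CMeta H) \<longleftrightarrow> True"

primrec arity_item :: "('c \<Rightarrow> nat) \<Rightarrow> ('c, 'h, 'r) item \<Rightarrow> bool" where
  "arity_item ar (CEq U U') \<longleftrightarrow> arity_ctm ar U \<and> arity_ctm ar U'"
| "arity_item ar (REq N N') \<longleftrightarrow> True"
| "arity_item ar (Def r U) \<longleftrightarrow> arity_ctm ar U"
| "arity_item ar Contra \<longleftrightarrow> True"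

definition unif_ctx :: "('c \<Rightarrow> nat) \<Rightarrow> ('c, 'h, 'r) ctx \<Rightarrow> bool" where
  "unif_ctx ar \<Delta> \<longleftrightarrow>
     finite \<Delta> \<and>
     (\<forall>i\<in>\<Delta>. arity_item ar i) \<and>
     (\<forall>r U U'. Def r U \<in> \<Delta> \<longrightarrow> Def r U' \<in> \<Delta> \<longrightarrow> U = U') \<and>
     (\<forall>i\<in>\<Delta>. \<forall>r\<in>rconsts_item i. \<exists>U. Def r U \<in> \<Delta>)"

datatype ('c, 'h) tree = Bot | Meta "'h mvar" | Node 'c "('c, 'h) tree list"

text \<open>Meaningful only if \<open>r\<close> has exactly one definition in \<open>\<Delta>\<close>.\<close>

definition body :: "('c, 'h, 'r) ctx \<Rightarrow> 'r \<Rightarrow> ('c, 'h, 'r) ctm" where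
  "body \<Delta> r = (THE U. Def r U \<in> \<Delta>)"

function
  exp_ctm :: "('c, 'h, 'r) ctx \<Rightarrow> nat \<Rightarrow> ('c, 'h, 'r) ctm \<Rightarrow> ('c, 'h) tree" and
  exp_rtm :: "('c, 'h, 'r) ctx \<Rightarrow> nat \<Rightarrow> ('h, 'r) rtm \<Rightarrow> ('c, 'h) tree" where
  "exp_ctm \<Delta> 0 U = Bot"
| "exp_ctm \<Delta> (Suc k) (CMeta H) = Meta (HCon H)"
| "exp_ctm \<Delta> (Suc k) (Con c Ns) = Node c (map (exp_rtm \<Delta> k) Ns)"
| "exp_rtm \<Delta> 0 N = Bot"
| "exp_rtm \<Delta> (Suc k) (RMeta H) = Meta (HRec H)"
| "exp_rtm \<Delta> (Suc k) (RConst r) = exp_ctm \<Delta> (Suc k) (body \<Delta> r)"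
  by pat_completeness auto
termination
  by (relation "measure (\<lambda>x. case x of Inl (_, k, _) \<Rightarrow> 2 * k | Inr (_, k, _) \<Rightarrow> 2 * k + 1)") auto

definition holds_ceq ::
    "('c, 'h, 'r) ctx \<Rightarrow> ('c, 'h, 'r) ctm \<Rightarrow> ('c, 'h, 'r) ctm \<Rightarrow> bool" where
  "holds_ceq \<Delta> U U' \<longleftrightarrow> (\<forall>k. exp_ctm \<Delta> k U = exp_ctm \<Delta> k U')"

definition holds_req ::
    "('c, 'h, 'r) ctx \<Rightarrow> ('h, 'r) rtm \<Rightarrow> ('h, 'r) rtm \<Rightarrow> bool" where
  "holds_req \<Delta> N N' \<longleftrightarrow> (\<forall>k. exp_rtm \<Delta> k N = exp_rtm \<Delta> k N')"

definition subst_dom :: "('c, 'h, 'r) ctx \<Rightarrow> 'h mvar set" where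
  "subst_dom \<Gamma> = {HCon H | H. \<exists>U. CEq (CMeta H) U \<in> \<Gamma>} \<union> {HRec H | H. \<exists>N. REq (RMeta H) N \<in> \<Gamma>}"

definition substitution :: "('c \<Rightarrow> nat) \<Rightarrow> ('c, 'h, 'r) ctx \<Rightarrow> bool" where
  "substitution ar \<Gamma> \<longleftrightarrow>
     unif_ctx ar \<Gamma> \<and> Contra \<notin> \<Gamma> \<and>
     (\<forall>V U. CEq V U \<in> \<Gamma> \<longrightarrow> (\<exists>H. V = CMeta H)) \<and>
     (\<forall>V N. REq V N \<in> \<Gamma> \<longrightarrow> (\<exists>H. V = RMeta H)) \<and>
     (\<forall>H U U'. CEq (CMeta H) U \<in> \<Gamma> \<longrightarrow> CEq (CMeta H) U' \<in> \<Gamma> \<longrightarrow> U = U') \<and>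
     (\<forall>H N N'. REq (RMeta H) N \<in> \<Gamma> \<longrightarrow> REq (RMeta H) N' \<in> \<Gamma> \<longrightarrow> N = N')"

primrec sub_rtm :: "('c, 'h, 'r) ctx \<Rightarrow> ('h, 'r) rtm \<Rightarrow> ('h, 'r) rtm" where
  "sub_rtm \<Gamma> (RConst r) = RConst r"
| "sub_rtm \<Gamma> (RMeta H) =
     (if HRec H \<in> subst_dom \<Gamma> then (THE N. REq (RMeta H) N \<in> \<Gamma>) else RMeta H)"

primrec sub_ctm :: "('c, 'h, 'r) ctx \<Rightarrow> ('c, 'h, 'r) ctm \<Rightarrow> ('c, 'h, 'r) ctm" where
  "sub_ctm \<Gamma> (Con c Ns) = Con c (map (sub_rtm \<Gamma>) Ns)"
| "sub_ctm \<Gamma> (CMeta H) =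
     (if HCon H \<in> subst_dom \<Gamma> then (THE U. CEq (CMeta H) U \<in> \<Gamma>) else CMeta H)"

text \<open>
  \<open>ctx_sub \<Delta> \<Gamma>\<close> is \<open>\<Delta>[\<Gamma>]\<close>, \<open>subst_sub \<Gamma>\<^sub>1 \<Gamma>\<^sub>2\<close> is \<open>\<Gamma>\<^sub>1[\<Gamma>\<^sub>2]\<close> and \<open>subst_comp \<Gamma>\<^sub>1 \<Gamma>\<^sub>2\<close> is
  \<open>\<Gamma>\<^sub>1 \<circ> \<Gamma>\<^sub>2\<close>, all for arguments whose recursion constants are already apart.
\<close>

definition ctx_sub :: "('c, 'h, 'r) ctx \<Rightarrow> ('c, 'h, 'r) ctx \<Rightarrow> ('c, 'h, 'r) ctx" where
  "ctx_sub \<Delta> \<Gamma> = defs \<Gamma> \<union>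
     {CEq (sub_ctm \<Gamma> U) (sub_ctm \<Gamma> U') | U U'. CEq U U' \<in> \<Delta>} \<union>
     {REq (sub_rtm \<Gamma> N) (sub_rtm \<Gamma> N') | N N'. REq N N' \<in> \<Delta>} \<union>
     {Def r (sub_ctm \<Gamma> U) | r U. Def r U \<in> \<Delta>}"

definition rhs_sub :: "('c, 'h, 'r) ctx \<Rightarrow> ('c, 'h, 'r) ctx \<Rightarrow> ('c, 'h, 'r) ctx" where
  "rhs_sub \<Gamma>\<^sub>1 \<Gamma>\<^sub>2 =
     {CEq (CMeta H) (sub_ctm \<Gamma>\<^sub>2 U) | H U. CEq (CMeta H) U \<in> \<Gamma>\<^sub>1} \<union>
     {REq (RMeta H) (sub_rtm \<Gamma>\<^sub>2 N) | H N. REq (RMeta H) N \<in> \<Gamma>\<^sub>1} \<union>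
     {Def r (sub_ctm \<Gamma>\<^sub>2 U) | r U. Def r U \<in> \<Gamma>\<^sub>1}"

definition subst_sub :: "('c, 'h, 'r) ctx \<Rightarrow> ('c, 'h, 'r) ctx \<Rightarrow> ('c, 'h, 'r) ctx" where
  "subst_sub \<Gamma>\<^sub>1 \<Gamma>\<^sub>2 = defs \<Gamma>\<^sub>2 \<union> rhs_sub \<Gamma>\<^sub>1 \<Gamma>\<^sub>2"

definition subst_comp :: "('c, 'h, 'r) ctx \<Rightarrow> ('c, 'h, 'r) ctx \<Rightarrow> ('c, 'h, 'r) ctx" where
  "subst_comp \<Gamma>\<^sub>1 \<Gamma>\<^sub>2 = subst_sub \<Gamma>\<^sub>1 \<Gamma>\<^sub>2 \<union>
     {CEq (CMeta H) U | H U. CEq (CMeta H) U \<in> \<Gamma>\<^sub>2 \<and> HCon H \<notin> subst_dom \<Gamma>\<^sub>1} \<union>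
     {REq (RMeta H) N | H N. REq (RMeta H) N \<in> \<Gamma>\<^sub>2 \<and> HRec H \<notin> subst_dom \<Gamma>\<^sub>1}"

text \<open>
  Renaming apart: recursion constants are local to their context, so whenever two contexts are
  combined, those of the first are tagged \<open>Inl\<close> and those of the second \<open>Inr\<close>.
\<close>

definition rename :: "('r \<Rightarrow> 's) \<Rightarrow> ('c, 'h, 'r) ctx \<Rightarrow> ('c, 'h, 's) ctx" where
  "rename f \<Delta> = map_item id id f ` \<Delta>"

definition ctx_sub_apart :: "('c, 'h, 'r) ctx \<Rightarrow> ('c, 'h, 's) ctx \<Rightarrow> ('c, 'h, 'r + 's) ctx" where
  "ctx_sub_apart \<Delta> \<Gamma> = ctx_sub (rename Inl \<Delta>) (rename Inr \<Gamma>)"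

definition subst_comp_apart ::
    "('c, 'h, 'r) ctx \<Rightarrow> ('c, 'h, 's) ctx \<Rightarrow> ('c, 'h, 'r + 's) ctx" where
  "subst_comp_apart \<Gamma>\<^sub>1 \<Gamma>\<^sub>2 = subst_comp (rename Inl \<Gamma>\<^sub>1) (rename Inr \<Gamma>\<^sub>2)"

text \<open>
  Expansions contain no recursion constants, so substitutions over different types of recursion
  constants can be compared.
\<close>

definition subst_eq :: "('c, 'h, 'r) ctx \<Rightarrow> ('c, 'h, 's) ctx \<Rightarrow> bool" where
  "subst_eq \<Gamma> \<Gamma>' \<longleftrightarrow>
     subst_dom \<Gamma> = subst_dom \<Gamma>' \<and>
     (\<forall>H. HCon H \<in> subst_dom \<Gamma> \<longrightarrow>
        (\<forall>k. exp_ctm \<Gamma> k (sub_ctm \<Gamma> (CMeta H)) = exp_ctm \<Gamma>' k (sub_ctm \<Gamma>' (CMeta H)))) \<and>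
     (\<forall>H. HRec H \<in> subst_dom \<Gamma> \<longrightarrow>
        (\<forall>k. exp_rtm \<Gamma> k (sub_rtm \<Gamma> (RMeta H)) = exp_rtm \<Gamma>' k (sub_rtm \<Gamma>' (RMeta H))))"

definition unifier :: "('c \<Rightarrow> nat) \<Rightarrow> ('c, 'h, 'r) ctx \<Rightarrow> ('c, 'h, 'r) ctx \<Rightarrow> bool" where
  "unifier ar \<Delta> \<Gamma> \<longleftrightarrow>
     Contra \<notin> \<Delta> \<and> substitution ar \<Gamma> \<and> subst_dom \<Gamma> = UV \<Delta> \<and>
     (\<forall>U U'. CEq U U' \<in> ctx_sub_apart \<Delta> \<Gamma> \<longrightarrow> holds_ceq (ctx_sub_apart \<Delta> \<Gamma>) U U') \<and>
     (\<forall>N N'. REq N N' \<in> ctx_sub_apart \<Delta> \<Gamma> \<longrightarrow> holds_req (ctx_sub_apart \<Delta> \<Gamma>) N N')"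

definition more_general :: "('c \<Rightarrow> nat) \<Rightarrow> ('c, 'h, 'r) ctx \<Rightarrow> ('c, 'h, 'r) ctx \<Rightarrow> bool" where
  "more_general ar \<Gamma>\<^sub>1 \<Gamma>\<^sub>2 \<longleftrightarrow>
     (\<exists>\<Gamma>' :: ('c, 'h, 'r) ctx. substitution ar \<Gamma>' \<and> subst_eq (subst_comp_apart \<Gamma>\<^sub>1 \<Gamma>') \<Gamma>\<^sub>2)"

definition most_general_unifier ::
    "('c \<Rightarrow> nat) \<Rightarrow> ('c, 'h, 'r) ctx \<Rightarrow> ('c, 'h, 'r) ctx \<Rightarrow> bool" where
  "most_general_unifier ar \<Delta> \<Gamma> \<longleftrightarrow>
     unifier ar \<Delta> \<Gamma> \<and> (\<forall>\<Gamma>\<^sub>2. unifier ar \<Delta> \<Gamma>\<^sub>2 \<longrightarrow> more_general ar \<Gamma> \<Gamma>\<^sub>2)"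

inductive derives :: "('c, 'h, 'r) ctx \<Rightarrow> ('c, 'h, 'r) item \<Rightarrow> bool" for \<Delta> where
  simp_f: "CEq (Con c Ns) (Con d Ns') \<in> \<Delta> \<Longrightarrow> c \<noteq> d \<Longrightarrow> derives \<Delta> Contra"
| simp: "CEq (Con c Ns) (Con c Ns') \<in> \<Delta> \<Longrightarrow> i < length Ns \<Longrightarrow> i < length Ns' \<Longrightarrow>
    derives \<Delta> (REq (Ns ! i) (Ns' ! i))"
| r_exp: "REq (RConst r) (RConst s) \<in> \<Delta> \<Longrightarrow> Def r U\<^sub>1 \<in> \<Delta> \<Longrightarrow> Def s U\<^sub>2 \<in> \<Delta> \<Longrightarrow>
    derives \<Delta> (CEq U\<^sub>1 U\<^sub>2)"
| c_sym: "CEq U\<^sub>1 U\<^sub>2 \<in> \<Delta> \<Longrightarrow> derives \<Delta> (CEq U\<^sub>2 U\<^sub>1)"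
| c_trans: "CEq U\<^sub>1 U\<^sub>2 \<in> \<Delta> \<Longrightarrow> CEq U\<^sub>2 U\<^sub>3 \<in> \<Delta> \<Longrightarrow> derives \<Delta> (CEq U\<^sub>1 U\<^sub>3)"
| r_sym: "REq N\<^sub>1 N\<^sub>2 \<in> \<Delta> \<Longrightarrow> derives \<Delta> (REq N\<^sub>2 N\<^sub>1)"
| r_trans: "REq N\<^sub>1 N\<^sub>2 \<in> \<Delta> \<Longrightarrow> REq N\<^sub>2 N\<^sub>3 \<in> \<Delta> \<Longrightarrow> derives \<Delta> (REq N\<^sub>1 N\<^sub>3)"

definition saturated :: "('c, 'h, 'r) ctx \<Rightarrow> bool" where
  "saturated \<Delta> \<longleftrightarrow> (\<forall>i. derives \<Delta> i \<longrightarrow> i \<in> \<Delta>)"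

definition c_resolution :: "('c, 'h, 'r) ctx \<Rightarrow> 'h \<Rightarrow> ('c, 'h, 'r) ctm \<Rightarrow> bool" where
  "c_resolution \<Delta> H U \<longleftrightarrow>
     (\<exists>c Ns. U = Con c Ns) \<and> (CEq (CMeta H) U \<in> \<Delta> \<or> CEq U (CMeta H) \<in> \<Delta>)"

definition r_resolution :: "('c, 'h, 'r) ctx \<Rightarrow> 'h \<Rightarrow> ('h, 'r) rtm \<Rightarrow> bool" where
  "r_resolution \<Delta> H N \<longleftrightarrow>
     (\<exists>r. N = RConst r) \<and> (REq (RMeta H) N \<in> \<Delta> \<or> REq N (RMeta H) \<in> \<Delta>)"

definition c_resolved :: "('c, 'h, 'r) ctx \<Rightarrow> 'h set" where
  "c_resolved \<Delta> = {H. HCon H \<in> UV \<Delta> \<and> (\<exists>U. c_resolution \<Delta> H U)}"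

definition r_resolved :: "('c, 'h, 'r) ctx \<Rightarrow> 'h set" where
  "r_resolved \<Delta> = {H. HRec H \<in> UV \<Delta> \<and> (\<exists>N. r_resolution \<Delta> H N)}"

definition c_unresolved :: "('c, 'h, 'r) ctx \<Rightarrow> 'h set" where
  "c_unresolved \<Delta> = {H. HCon H \<in> UV \<Delta> \<and> H \<notin> c_resolved \<Delta>}"

definition r_unresolved :: "('c, 'h, 'r) ctx \<Rightarrow> 'h set" where
  "r_unresolved \<Delta> = {H. HRec H \<in> UV \<Delta> \<and> H \<notin> r_resolved \<Delta>}"

text \<open>
  The equivalences on unresolved metavariables are the reflexive, symmetric and transitive closures
  of the equations between them (a saturated context need not contain \<open>H \<doteq> H\<close>).
\<close>

definition c_equiv :: "('c, 'h, 'r) ctx \<Rightarrow> ('h \<times> 'h) set" where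
  "c_equiv \<Delta> =
     (let E = {(H, G). H \<in> c_unresolved \<Delta> \<and> G \<in> c_unresolved \<Delta> \<and> CEq (CMeta H) (CMeta G) \<in> \<Delta>}
      in (E \<union> E\<inverse>)\<^sup>*)"

definition r_equiv :: "('c, 'h, 'r) ctx \<Rightarrow> ('h \<times> 'h) set" where
  "r_equiv \<Delta> =
     (let E = {(H, G). H \<in> r_unresolved \<Delta> \<and> G \<in> r_unresolved \<Delta> \<and> REq (RMeta H) (RMeta G) \<in> \<Delta>}
      in (E \<union> E\<inverse>)\<^sup>*)"

text \<open>
  A choice consists of functions giving resolutions (\<open>cres\<close>, \<open>rres\<close>) and class representatives
  (\<open>crep\<close>, \<open>rrep\<close>); their values elsewhere are irrelevant.
\<close>

definition valid_choice ::
    "('c, 'h, 'r) ctx \<Rightarrow> ('h \<Rightarrow> ('c, 'h, 'r) ctm) \<Rightarrow> ('h \<Rightarrow> ('h, 'r) rtm) \<Rightarrow>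
     ('h \<Rightarrow> 'h) \<Rightarrow> ('h \<Rightarrow> 'h) \<Rightarrow> bool" where
  "valid_choice \<Delta> cres rres crep rrep \<longleftrightarrow>
     (\<forall>H\<in>c_resolved \<Delta>. c_resolution \<Delta> H (cres H)) \<and>
     (\<forall>H\<in>r_resolved \<Delta>. r_resolution \<Delta> H (rres H)) \<and>
     (\<forall>H\<in>c_unresolved \<Delta>. (H, crep H) \<in> c_equiv \<Delta>) \<and>
     (\<forall>H\<in>c_unresolved \<Delta>. \<forall>G\<in>c_unresolved \<Delta>. (H, G) \<in> c_equiv \<Delta> \<longrightarrow> crep H = crep G) \<and>
     (\<forall>H\<in>r_unresolved \<Delta>. (H, rrep H) \<in> r_equiv \<Delta>) \<and>
     (\<forall>H\<in>r_unresolved \<Delta>. \<forall>G\<in>r_unresolved \<Delta>. (H, G) \<in> r_equiv \<Delta> \<longrightarrow> rrep H = rrep G)"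

lemma valid_choice_exists: "\<exists>cres rres crep rrep. valid_choice \<Delta> cres rres crep rrep"
proof -
  have rep: "\<exists>f. (\<forall>H. (H, f H) \<in> R) \<and> (\<forall>H G. (H, G) \<in> R \<longrightarrow> f H = f G)"
    if "equiv UNIV R" for R :: "('h \<times> 'h) set"
  proof (intro exI conjI allI impI)
    fix H G
    show "(H, SOME G. (H, G) \<in> R) \<in> R"
      using that by (metis UNIV_I equiv_class_self Image_singleton_iff someI)
    assume "(H, G) \<in> R"
    then have "R `` {H} = R `` {G}" using that by (rule equiv_class_eq[rotated])
    then show "(SOME G. (H, G) \<in> R) = (SOME H. (G, H) \<in> R)"
      by (metis Image_singleton_iff)
  qed
  have eqv: "equiv UNIV ((E \<union> E\<inverse>)\<^sup>*)" for E :: "('h \<times> 'h) set"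
    by (rule equivI) (auto intro: refl_rtrancl trans_rtrancl sym_rtrancl sym_Un_converse)
  have "equiv UNIV (c_equiv \<Delta>)" "equiv UNIV (r_equiv \<Delta>)"
    unfolding c_equiv_def r_equiv_def Let_def by (rule eqv)+
  from this[THEN rep] obtain f g where
    "\<forall>H. (H, f H) \<in> c_equiv \<Delta>" "\<forall>H G. (H, G) \<in> c_equiv \<Delta> \<longrightarrow> f H = f G"
    "\<forall>H. (H, g H) \<in> r_equiv \<Delta>" "\<forall>H G. (H, G) \<in> r_equiv \<Delta> \<longrightarrow> g H = g G"
    by blast
  moreover have "\<forall>H\<in>c_resolved \<Delta>. c_resolution \<Delta> H (SOME U. c_resolution \<Delta> H U)"
    by (auto simp: c_resolved_def intro: someI)
  moreover have "\<forall>H\<in>r_resolved \<Delta>. r_resolution \<Delta> H (SOME N. r_resolution \<Delta> H N)"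
    by (auto simp: r_resolved_def intro: someI)
  ultimately have "valid_choice \<Delta> (\<lambda>H. SOME U. c_resolution \<Delta> H U) (\<lambda>H. SOME N. r_resolution \<Delta> H N) f g"
    unfolding valid_choice_def by simp
  then show ?thesis by blast
qed

definition unif_start ::
    "('c, 'h, 'r) ctx \<Rightarrow> ('h \<Rightarrow> ('c, 'h, 'r) ctm) \<Rightarrow> ('h \<Rightarrow> ('h, 'r) rtm) \<Rightarrow>
     ('h \<Rightarrow> 'h) \<Rightarrow> ('h \<Rightarrow> 'h) \<Rightarrow> ('c, 'h, 'r) ctx" where
  "unif_start \<Delta> cres rres crep rrep =
     defs \<Delta> \<union>
     {CEq (CMeta H) (cres H) | H. H \<in> c_resolved \<Delta>} \<union>
     {REq (RMeta H) (rres H) | H. H \<in> r_resolved \<Delta>} \<union>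
     {CEq (CMeta H) (CMeta (crep H)) | H. H \<in> c_unresolved \<Delta>} \<union>
     {REq (RMeta H) (RMeta (rrep H)) | H. H \<in> r_unresolved \<Delta>}"

definition representatives ::
    "('c, 'h, 'r) ctx \<Rightarrow> ('h \<Rightarrow> 'h) \<Rightarrow> ('h \<Rightarrow> 'h) \<Rightarrow> 'h mvar set" where
  "representatives \<Delta> crep rrep =
     (\<lambda>H. HCon (crep H)) ` c_unresolved \<Delta> \<union> (\<lambda>H. HRec (rrep H)) ` r_unresolved \<Delta>"

definition rhs_uv :: "('c, 'h, 'r) ctx \<Rightarrow> 'h mvar set" where
  "rhs_uv \<Gamma> =
     \<Union> {uv_ctm U | V U. CEq V U \<in> \<Gamma>} \<union> \<Union> {uv_rtm N | V N. REq V N \<in> \<Gamma>} \<union>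
     \<Union> {uv_ctm U | r U. Def r U \<in> \<Gamma>}"

text \<open>
  As a substitution, \<open>unif_start\<close> maps each resolved metavariable to its resolution and each
  unresolved one to its representative, so one round of replacement is \<open>rhs_sub _ \<Gamma>\<^sub>0\<close>.
\<close>

definition unif ::
    "('c, 'h, 'r) ctx \<Rightarrow> ('h \<Rightarrow> ('c, 'h, 'r) ctm) \<Rightarrow> ('h \<Rightarrow> ('h, 'r) rtm) \<Rightarrow>
     ('h \<Rightarrow> 'h) \<Rightarrow> ('h \<Rightarrow> 'h) \<Rightarrow> ('c, 'h, 'r) ctx" where
  "unif \<Delta> cres rres crep rrep =
     (let \<Gamma>\<^sub>0 = unif_start \<Delta> cres rres crep rrep
      in while (\<lambda>\<Gamma>. \<not> rhs_uv \<Gamma> \<subseteq> representatives \<Delta> crep rrep) (\<lambda>\<Gamma>. rhs_sub \<Gamma> \<Gamma>\<^sub>0) \<Gamma>\<^sub>0)"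

end

theory Submission
  imports Defs
begin

text \<open>
  Two rounds of replacement reach a normal form \<open>\<sigma>\<close>, so \<open>\<Gamma> = unif(\<Delta>)\<close> consists of the equations
  \<open>H \<doteq> \<sigma> H\<close> and the definitions \<open>r =\<^sub>d \<sigma> U\<close>. By induction on the depth, the expansion of
  \<open>\<sigma> M\<close> in \<open>\<Gamma>\<close> is that of \<open>M[\<Gamma>]\<close> in \<open>\<Delta>[\<Gamma>]\<close>. By saturation, the two sides of
  an equation of \<open>\<Delta>\<close> are either unresolved metavariables with a common representative, or reduce to
  equated constructor terms (whose arguments are again equated) or equated constants (whose bodies
  are); a second induction on the depth shows that \<open>\<Gamma>\<close> is a unifier.

  If \<open>\<Gamma>\<^sub>2\<close> is any unifier, every replacement made by \<open>\<sigma>\<close> follows equations of \<open>\<Delta>\<close>, which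
  hold after applying \<open>\<Gamma>\<^sub>2\<close>. Hence \<open>\<Gamma> \<circ> \<Gamma>\<^sub>2 = \<Gamma>\<^sub>2\<close>, so \<open>\<Gamma>\<^sub>2\<close> itself witnesses that
  \<open>\<Gamma>\<close> is more general.
\<close>

section \<open>Expansion after instantiation\<close>

text \<open>Since \<open>body\<close> is a definite description, the lemmas that compare expansions
  across renaming or replacement assume that the recursion constants of a term lie in this
  set.\<close>

definition defined :: "('c, 'h, 'r) ctx \<Rightarrow> 'r set" where
  "defined \<Delta> = {r. \<exists>U. Def r U \<in> \<Delta>}"

section \<open>Renaming of recursion constants and values of metavariables\<close>

lemma CEq_rename_iff:
  "CEq V V' \<in> rename f \<Delta> \<longleftrightarrow>
     (\<exists>U U'. V = map_ctm id id f U \<and> V' = map_ctm id id f U' \<and> CEq U U' \<in> \<Delta>)"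
proof
  assume "CEq V V' \<in> rename f \<Delta>"
  then obtain i where "i \<in> \<Delta>" "map_item id id f i = CEq V V'"
    by (auto simp: rename_def)
  then show "\<exists>U U'. V = map_ctm id id f U \<and> V' = map_ctm id id f U' \<and> CEq U U' \<in> \<Delta>"
    by (cases i) auto
qed (force simp: rename_def)

lemma REq_rename_iff:
  "REq V V' \<in> rename f \<Delta> \<longleftrightarrow>
     (\<exists>N N'. V = map_rtm id f N \<and> V' = map_rtm id f N' \<and> REq N N' \<in> \<Delta>)"
proof
  assume "REq V V' \<in> rename f \<Delta>"
  then obtain i where "i \<in> \<Delta>" "map_item id id f i = REq V V'"
    by (auto simp: rename_def)
  then show "\<exists>N N'. V = map_rtm id f N \<and> V' = map_rtm id f N' \<and> REq N N' \<in> \<Delta>"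
    by (cases i) auto
qed (force simp: rename_def)

lemma Def_rename_iff:
  "Def q V \<in> rename f \<Delta> \<longleftrightarrow> (\<exists>r U. q = f r \<and> V = map_ctm id id f U \<and> Def r U \<in> \<Delta>)"
proof
  assume "Def q V \<in> rename f \<Delta>"
  then obtain i where "i \<in> \<Delta>" "map_item id id f i = Def q V"
    by (auto simp: rename_def)
  then show "\<exists>r U. q = f r \<and> V = map_ctm id id f U \<and> Def r U \<in> \<Delta>"
    by (cases i) auto
qed (force simp: rename_def)

lemma map_ctm_eq_CMeta_iff: "map_ctm id id f U = CMeta H \<longleftrightarrow> U = CMeta H"
  by (cases U) auto

lemma map_rtm_eq_RMeta_iff: "map_rtm id f N = RMeta H \<longleftrightarrow> N = RMeta H"
  by (cases N) auto

lemma CEq_rename_CMeta_iff: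
  "CEq (CMeta H) V \<in> rename f \<Gamma> \<longleftrightarrow> (\<exists>U. V = map_ctm id id f U \<and> CEq (CMeta H) U \<in> \<Gamma>)"
  using map_ctm_eq_CMeta_iff[of f _ H] unfolding CEq_rename_iff by metis

lemma REq_rename_RMeta_iff:
  "REq (RMeta H) V \<in> rename f \<Gamma> \<longleftrightarrow> (\<exists>N. V = map_rtm id f N \<and> REq (RMeta H) N \<in> \<Gamma>)"
  using map_rtm_eq_RMeta_iff[of f _ H] unfolding REq_rename_iff by metis

lemma subst_dom_rename: "subst_dom (rename f \<Gamma>) = subst_dom \<Gamma>"
proof -
  have "(\<exists>U. CEq (CMeta H) U \<in> rename f \<Gamma>) \<longleftrightarrow> (\<exists>U. CEq (CMeta H) U \<in> \<Gamma>)"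
    "(\<exists>N. REq (RMeta H) N \<in> rename f \<Gamma>) \<longleftrightarrow> (\<exists>N. REq (RMeta H) N \<in> \<Gamma>)" for H
    unfolding CEq_rename_CMeta_iff REq_rename_RMeta_iff by blast+
  then show ?thesis unfolding subst_dom_def by simp
qed

lemma CEq_rename_CMeta_subst_dom: "CEq (CMeta H) V \<in> rename f \<Gamma> \<Longrightarrow> HCon H \<in> subst_dom \<Gamma>"
  by (auto simp: CEq_rename_CMeta_iff subst_dom_def)

lemma REq_rename_RMeta_subst_dom: "REq (RMeta H) V \<in> rename f \<Gamma> \<Longrightarrow> HRec H \<in> subst_dom \<Gamma>"
  by (auto simp: REq_rename_RMeta_iff subst_dom_def)

lemma sub_CMeta_eq:
  assumes "substitution ar \<Gamma>" "CEq (CMeta H) U \<in> \<Gamma>"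
  shows "sub_ctm \<Gamma> (CMeta H) = U"
proof -
  have "(THE U. CEq (CMeta H) U \<in> \<Gamma>) = U"
    using assms by (intro the_equality) (auto simp: substitution_def)
  then show ?thesis using assms(2) by (auto simp: subst_dom_def)
qed

lemma sub_RMeta_eq:
  assumes "substitution ar \<Gamma>" "REq (RMeta H) N \<in> \<Gamma>"
  shows "sub_rtm \<Gamma> (RMeta H) = N"
proof -
  have "(THE N. REq (RMeta H) N \<in> \<Gamma>) = N"
    using assms by (intro the_equality) (auto simp: substitution_def)
  then show ?thesis using assms(2) by (auto simp: subst_dom_def)
qed

lemma sub_CMeta_mem:
  assumes "substitution ar \<Gamma>" "HCon H \<in> subst_dom \<Gamma>"
  shows "CEq (CMeta H) (sub_ctm \<Gamma> (CMeta H)) \<in> \<Gamma>"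
  using assms sub_CMeta_eq[OF assms(1)] by (auto simp: subst_dom_def simp del: sub_ctm.simps)

lemma sub_RMeta_mem:
  assumes "substitution ar \<Gamma>" "HRec H \<in> subst_dom \<Gamma>"
  shows "REq (RMeta H) (sub_rtm \<Gamma> (RMeta H)) \<in> \<Gamma>"
  using assms sub_RMeta_eq[OF assms(1)] by (auto simp: subst_dom_def simp del: sub_rtm.simps)

text \<open>Renaming leaves the metavariable on the left untouched, so its value stays unique even
  when \<open>f\<close> is not injective.\<close>

lemma sub_rename_CMeta:
  assumes "substitution ar \<Gamma>"
  shows "sub_ctm (rename f \<Gamma>) (CMeta H) = map_ctm id id f (sub_ctm \<Gamma> (CMeta H))"
proof (cases "HCon H \<in> subst_dom \<Gamma>")
  case True
  then obtain U where U: "CEq (CMeta H) U \<in> \<Gamma>" by (auto simp: subst_dom_def)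
  have "(THE V. CEq (CMeta H) V \<in> rename f \<Gamma>) = map_ctm id id f U"
  proof (rule the_equality)
    show "CEq (CMeta H) (map_ctm id id f U) \<in> rename f \<Gamma>"
      using U by (simp add: CEq_rename_CMeta_iff) blast
    show "V = map_ctm id id f U" if "CEq (CMeta H) V \<in> rename f \<Gamma>" for V
      using that U sub_CMeta_eq[OF assms] by (auto simp only: CEq_rename_CMeta_iff)
  qed
  then show ?thesis using True sub_CMeta_eq[OF assms U] by (simp add: subst_dom_rename)
qed (simp add: subst_dom_rename)

lemma sub_rename_RMeta:
  assumes "substitution ar \<Gamma>"
  shows "sub_rtm (rename f \<Gamma>) (RMeta H) = map_rtm id f (sub_rtm \<Gamma> (RMeta H))"
proof (cases "HRec H \<in> subst_dom \<Gamma>")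
  case True
  then obtain N where N: "REq (RMeta H) N \<in> \<Gamma>" by (auto simp: subst_dom_def)
  have "(THE V. REq (RMeta H) V \<in> rename f \<Gamma>) = map_rtm id f N"
  proof (rule the_equality)
    show "REq (RMeta H) (map_rtm id f N) \<in> rename f \<Gamma>"
      using N by (simp add: REq_rename_RMeta_iff) blast
    show "V = map_rtm id f N" if "REq (RMeta H) V \<in> rename f \<Gamma>" for V
      using that N sub_RMeta_eq[OF assms] by (auto simp only: REq_rename_RMeta_iff)
  qed
  then show ?thesis using True sub_RMeta_eq[OF assms N] by (simp add: subst_dom_rename)
qed (simp add: subst_dom_rename)

section \<open>Expansions and their dependence on definition bodies\<close>

lemma body_eq:
  assumes "unif_ctx ar \<Delta>" "Def r U \<in> \<Delta>"
  shows "body \<Delta> r = U"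
  using assms unfolding body_def unif_ctx_def by blast

text \<open>An expansion consults its context only through \<open>body\<close>; the equations in the
  context do not matter.\<close>

lemma exp_cong:
  assumes "\<And>r. body \<Delta> r = body \<Delta>' r"
  shows "exp_ctm \<Delta> k U = exp_ctm \<Delta>' k U" "exp_rtm \<Delta> k N = exp_rtm \<Delta>' k N"
proof (induction k arbitrary: U N)
  case (Suc k)
  { case 1 show ?case using Suc by (cases U) auto }
  \<comment> \<open>A constant expands to its body at the same depth, so the recursive claim at
    \<open>Suc k\<close> uses the contractive claim at \<open>Suc k\<close>, not the induction
    hypothesis. The later inductions on the depth follow the same order.\<close>
  note c = this
  { case 2 show ?case using c by (cases N) (auto simp: assms) }
qed auto

lemma exp_map:
  assumes "\<And>r. r \<in> defined \<Gamma> \<Longrightarrow> body \<Theta> (f r) = map_ctm id id f (body \<Gamma> r)"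
    and "\<And>r. r \<in> defined \<Gamma> \<Longrightarrow> rconsts_ctm (body \<Gamma> r) \<subseteq> defined \<Gamma>"
  shows "rconsts_ctm U \<subseteq> defined \<Gamma> \<Longrightarrow> exp_ctm \<Theta> k (map_ctm id id f U) = exp_ctm \<Gamma> k U"
    and "rconsts_rtm N \<subseteq> defined \<Gamma> \<Longrightarrow> exp_rtm \<Theta> k (map_rtm id f N) = exp_rtm \<Gamma> k N"
proof (induction k arbitrary: U N)
  case (Suc k)
  { case 1 then show ?case
      by (cases U) (auto simp: UN_subset_iff intro!: Suc(2)[unfolded id_def]) }
  note c = this
  { case 2 then show ?case by (cases N) (auto simp: assms(1) c[OF assms(2)]) }
qed auto

lemma rconsts_Def:
  assumes "unif_ctx ar \<Delta>" "Def r U \<in> \<Delta>"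
  shows "rconsts_ctm U \<subseteq> defined \<Delta>"
  using assms unfolding unif_ctx_def defined_def by fastforce

lemma rconsts_CEq:
  assumes "unif_ctx ar \<Delta>" "CEq U U' \<in> \<Delta>"
  shows "rconsts_ctm U \<subseteq> defined \<Delta>" "rconsts_ctm U' \<subseteq> defined \<Delta>"
  using assms unfolding unif_ctx_def defined_def by fastforce+

lemma rconsts_REq:
  assumes "unif_ctx ar \<Delta>" "REq N N' \<in> \<Delta>"
  shows "rconsts_rtm N \<subseteq> defined \<Delta>" "rconsts_rtm N' \<subseteq> defined \<Delta>"
  using assms unfolding unif_ctx_def defined_def by fastforce+

text \<open>The two alternatives carry different tags, so definitions of the two contexts cannot
  clash and the constants of the combined context inherit unique bodies.\<close>

lemma Def_ctx_sub_apart_iff: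
  "Def q V \<in> ctx_sub_apart \<Delta> \<Gamma> \<longleftrightarrow>
     (\<exists>r U. q = Inr r \<and> V = map_ctm id id Inr U \<and> Def r U \<in> \<Gamma>) \<or>
     (\<exists>r U. q = Inl r \<and> V = sub_ctm (rename Inr \<Gamma>) (map_ctm id id Inl U) \<and> Def r U \<in> \<Delta>)"
  unfolding ctx_sub_apart_def ctx_sub_def defs_def by (auto simp: Def_rename_iff)

lemma body_ctx_sub_apart_Inl:
  assumes "unif_ctx ar \<Delta>" "Def r U \<in> \<Delta>"
  shows "body (ctx_sub_apart \<Delta> \<Gamma>) (Inl r) = sub_ctm (rename Inr \<Gamma>) (map_ctm id id Inl U)"
  using assms unfolding body_def Def_ctx_sub_apart_iff unif_ctx_def
  by (intro the_equality) auto

lemma body_ctx_sub_apart_Inr: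
  assumes "unif_ctx ar \<Gamma>" "Def r U \<in> \<Gamma>"
  shows "body (ctx_sub_apart \<Delta> \<Gamma>) (Inr r) = map_ctm id id Inr U"
  using assms unfolding body_def Def_ctx_sub_apart_iff unif_ctx_def
  by (intro the_equality) auto

text \<open>The definitions of \<Gamma> enter the combined context without substitution, and their
  bodies mention only constants of \<Gamma>, so an expansion started there never meets a definition
  of \<Delta>.\<close>

lemma exp_ctx_sub_apart_Inr:
  assumes "unif_ctx ar \<Gamma>"
  shows "rconsts_ctm U \<subseteq> defined \<Gamma> \<Longrightarrow>
      exp_ctm (ctx_sub_apart \<Delta> \<Gamma>) k (map_ctm id id Inr U) = exp_ctm \<Gamma> k U"
    and "rconsts_rtm N \<subseteq> defined \<Gamma> \<Longrightarrow>
      exp_rtm (ctx_sub_apart \<Delta> \<Gamma>) k (map_rtm id Inr N) = exp_rtm \<Gamma> k N"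
proof -
  have 1: "body (ctx_sub_apart \<Delta> \<Gamma>) (Inr r) = map_ctm id id Inr (body \<Gamma> r)"
    and 2: "rconsts_ctm (body \<Gamma> r) \<subseteq> defined \<Gamma>" if "r \<in> defined \<Gamma>" for r
    using that body_ctx_sub_apart_Inr[OF assms] body_eq[OF assms] rconsts_Def[OF assms]
    unfolding defined_def by fastforce+
  show "rconsts_ctm U \<subseteq> defined \<Gamma> \<Longrightarrow>
      exp_ctm (ctx_sub_apart \<Delta> \<Gamma>) k (map_ctm id id Inr U) = exp_ctm \<Gamma> k U"
    using exp_map(1)[of \<Gamma> _ Inr] 1 2 by blast
  show "rconsts_rtm N \<subseteq> defined \<Gamma> \<Longrightarrow>
      exp_rtm (ctx_sub_apart \<Delta> \<Gamma>) k (map_rtm id Inr N) = exp_rtm \<Gamma> k N"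
    using exp_map(2)[of \<Gamma> _ Inr] 1 2 by blast
qed

text \<open>The expansion of \<open>M[\<Gamma>]\<close> in \<open>\<Delta>[\<Gamma>]\<close>, for a term \<open>M\<close> over the recursion constants of \<open>\<Delta>\<close>.\<close>

definition inst_ctm ::
    "('c, 'h, 'r) ctx \<Rightarrow> ('c, 'h, 's) ctx \<Rightarrow> nat \<Rightarrow> ('c, 'h, 'r) ctm \<Rightarrow> ('c, 'h) tree" where
  "inst_ctm \<Delta> \<Gamma> k U =
     exp_ctm (ctx_sub_apart \<Delta> \<Gamma>) k (sub_ctm (rename Inr \<Gamma>) (map_ctm id id Inl U))"

definition inst_rtm ::
    "('c, 'h, 'r) ctx \<Rightarrow> ('c, 'h, 's) ctx \<Rightarrow> nat \<Rightarrow> ('h, 'r) rtm \<Rightarrow> ('c, 'h) tree" where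
  "inst_rtm \<Delta> \<Gamma> k N =
     exp_rtm (ctx_sub_apart \<Delta> \<Gamma>) k (sub_rtm (rename Inr \<Gamma>) (map_rtm id Inl N))"

lemma inst_0 [simp]: "inst_ctm \<Delta> \<Gamma> 0 U = Bot" "inst_rtm \<Delta> \<Gamma> 0 N = Bot"
  by (simp_all add: inst_ctm_def inst_rtm_def)

text \<open>Together with \<open>inst_RConst\<close>, \<open>inst_CMeta\<close> and
  \<open>inst_RMeta\<close> this computes instantiated expansions recursively, so that the
  inductions on the depth need not unfold the tagged contexts.\<close>

lemma inst_Con: "inst_ctm \<Delta> \<Gamma> (Suc k) (Con c Ns) = Node c (map (inst_rtm \<Delta> \<Gamma> k) Ns)"
  by (simp add: inst_ctm_def inst_rtm_def)

lemma inst_RConst: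
  assumes "unif_ctx ar \<Delta>" "Def r U \<in> \<Delta>"
  shows "inst_rtm \<Delta> \<Gamma> k (RConst r) = inst_ctm \<Delta> \<Gamma> k U"
  using body_ctx_sub_apart_Inl[OF assms, of \<Gamma>]
  by (cases k) (simp_all add: inst_rtm_def inst_ctm_def)

text \<open>The value of \<open>H\<close> contains only constants of \<Gamma>. Hence the right-hand
  side does not depend on \<Delta>, which later allows a change of the first context at a
  metavariable.\<close>

lemma inst_CMeta:
  assumes "substitution ar \<Gamma>"
  shows "inst_ctm \<Delta> \<Gamma> k (CMeta H) = exp_ctm \<Gamma> k (sub_ctm \<Gamma> (CMeta H))"
proof -
  have u: "unif_ctx ar \<Gamma>" using assms by (simp add: substitution_def)
  have "rconsts_ctm (sub_ctm \<Gamma> (CMeta H)) \<subseteq> defined \<Gamma>"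
    using rconsts_CEq(2)[OF u sub_CMeta_mem[OF assms]]
    by (cases "HCon H \<in> subst_dom \<Gamma>") auto
  then show ?thesis
    by (simp add: inst_ctm_def sub_rename_CMeta[OF assms] exp_ctx_sub_apart_Inr(1)[OF u]
        del: sub_ctm.simps)
qed

lemma inst_RMeta:
  assumes "substitution ar \<Gamma>"
  shows "inst_rtm \<Delta> \<Gamma> k (RMeta H) = exp_rtm \<Gamma> k (sub_rtm \<Gamma> (RMeta H))"
proof -
  have u: "unif_ctx ar \<Gamma>" using assms by (simp add: substitution_def)
  have "rconsts_rtm (sub_rtm \<Gamma> (RMeta H)) \<subseteq> defined \<Gamma>"
    using rconsts_REq(2)[OF u sub_RMeta_mem[OF assms]]
    by (cases "HRec H \<in> subst_dom \<Gamma>") auto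
  then show ?thesis
    by (simp add: inst_rtm_def sub_rename_RMeta[OF assms] exp_ctx_sub_apart_Inr(2)[OF u]
        del: sub_rtm.simps)
qed

section \<open>Unifiers and composition in terms of instantiated expansions\<close>

lemma CEq_ctx_sub_apart_iff:
  "CEq V V' \<in> ctx_sub_apart \<Delta> \<Gamma> \<longleftrightarrow>
     (\<exists>U U'. V = sub_ctm (rename Inr \<Gamma>) (map_ctm id id Inl U) \<and>
       V' = sub_ctm (rename Inr \<Gamma>) (map_ctm id id Inl U') \<and> CEq U U' \<in> \<Delta>)"
  unfolding ctx_sub_apart_def ctx_sub_def defs_def by (auto simp: CEq_rename_iff)

lemma REq_ctx_sub_apart_iff:
  "REq V V' \<in> ctx_sub_apart \<Delta> \<Gamma> \<longleftrightarrow>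
     (\<exists>N N'. V = sub_rtm (rename Inr \<Gamma>) (map_rtm id Inl N) \<and>
       V' = sub_rtm (rename Inr \<Gamma>) (map_rtm id Inl N') \<and> REq N N' \<in> \<Delta>)"
  unfolding ctx_sub_apart_def ctx_sub_def defs_def by (auto simp: REq_rename_iff)

lemma unifier_iff:
  "unifier ar \<Delta> \<Gamma> \<longleftrightarrow>
     Contra \<notin> \<Delta> \<and> substitution ar \<Gamma> \<and> subst_dom \<Gamma> = UV \<Delta> \<and>
     (\<forall>U U'. CEq U U' \<in> \<Delta> \<longrightarrow> (\<forall>k. inst_ctm \<Delta> \<Gamma> k U = inst_ctm \<Delta> \<Gamma> k U')) \<and>
     (\<forall>N N'. REq N N' \<in> \<Delta> \<longrightarrow> (\<forall>k. inst_rtm \<Delta> \<Gamma> k N = inst_rtm \<Delta> \<Gamma> k N'))"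
  unfolding unifier_def CEq_ctx_sub_apart_iff REq_ctx_sub_apart_iff holds_ceq_def holds_req_def
    inst_ctm_def inst_rtm_def
  by blast

text \<open>The two contexts contain the same definitions and differ only in their equations, which
  expansions ignore.\<close>

lemma exp_subst_comp_apart:
  "exp_ctm (subst_comp_apart \<Gamma>\<^sub>1 \<Gamma>\<^sub>2) k U = exp_ctm (ctx_sub_apart \<Gamma>\<^sub>1 \<Gamma>\<^sub>2) k U"
  "exp_rtm (subst_comp_apart \<Gamma>\<^sub>1 \<Gamma>\<^sub>2) k N = exp_rtm (ctx_sub_apart \<Gamma>\<^sub>1 \<Gamma>\<^sub>2) k N"
proof -
  have "Def r U \<in> subst_comp_apart \<Gamma>\<^sub>1 \<Gamma>\<^sub>2 \<longleftrightarrow> Def r U \<in> ctx_sub_apart \<Gamma>\<^sub>1 \<Gamma>\<^sub>2" for r U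
    unfolding subst_comp_apart_def subst_comp_def subst_sub_def rhs_sub_def ctx_sub_apart_def
      ctx_sub_def by auto
  then have "body (subst_comp_apart \<Gamma>\<^sub>1 \<Gamma>\<^sub>2) r = body (ctx_sub_apart \<Gamma>\<^sub>1 \<Gamma>\<^sub>2) r" for r
    by (simp add: body_def)
  note exp_cong[OF this]
  then show "exp_ctm (subst_comp_apart \<Gamma>\<^sub>1 \<Gamma>\<^sub>2) k U = exp_ctm (ctx_sub_apart \<Gamma>\<^sub>1 \<Gamma>\<^sub>2) k U"
    "exp_rtm (subst_comp_apart \<Gamma>\<^sub>1 \<Gamma>\<^sub>2) k N = exp_rtm (ctx_sub_apart \<Gamma>\<^sub>1 \<Gamma>\<^sub>2) k N"
    by blast+
qed

text \<open>With equal domains, composition adds no equation from the second substitution, since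
  each of its metavariables already has a value in the first.\<close>

lemma CEq_subst_comp_apart_iff:
  assumes "subst_dom \<Gamma>\<^sub>1 = subst_dom \<Gamma>\<^sub>2"
  shows "CEq (CMeta H) V \<in> subst_comp_apart \<Gamma>\<^sub>1 \<Gamma>\<^sub>2 \<longleftrightarrow>
    (\<exists>U. V = sub_ctm (rename Inr \<Gamma>\<^sub>2) (map_ctm id id Inl U) \<and> CEq (CMeta H) U \<in> \<Gamma>\<^sub>1)"
proof -
  have "CEq (CMeta H) V \<in> subst_comp_apart \<Gamma>\<^sub>1 \<Gamma>\<^sub>2 \<longleftrightarrow>
      (\<exists>U. V = sub_ctm (rename Inr \<Gamma>\<^sub>2) U \<and> CEq (CMeta H) U \<in> rename Inl \<Gamma>\<^sub>1)"
    unfolding subst_comp_apart_def subst_comp_def subst_sub_def rhs_sub_def defs_def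
    by (auto simp: subst_dom_rename assms CEq_rename_CMeta_subst_dom)
  also have "\<dots> \<longleftrightarrow> (\<exists>U. V = sub_ctm (rename Inr \<Gamma>\<^sub>2) (map_ctm id id Inl U) \<and>
      CEq (CMeta H) U \<in> \<Gamma>\<^sub>1)"
    unfolding CEq_rename_CMeta_iff by blast
  finally show ?thesis .
qed

lemma REq_subst_comp_apart_iff:
  assumes "subst_dom \<Gamma>\<^sub>1 = subst_dom \<Gamma>\<^sub>2"
  shows "REq (RMeta H) V \<in> subst_comp_apart \<Gamma>\<^sub>1 \<Gamma>\<^sub>2 \<longleftrightarrow>
    (\<exists>N. V = sub_rtm (rename Inr \<Gamma>\<^sub>2) (map_rtm id Inl N) \<and> REq (RMeta H) N \<in> \<Gamma>\<^sub>1)"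
proof -
  have "REq (RMeta H) V \<in> subst_comp_apart \<Gamma>\<^sub>1 \<Gamma>\<^sub>2 \<longleftrightarrow>
      (\<exists>N. V = sub_rtm (rename Inr \<Gamma>\<^sub>2) N \<and> REq (RMeta H) N \<in> rename Inl \<Gamma>\<^sub>1)"
    unfolding subst_comp_apart_def subst_comp_def subst_sub_def rhs_sub_def defs_def
    by (auto simp: subst_dom_rename assms REq_rename_RMeta_subst_dom)
  also have "\<dots> \<longleftrightarrow> (\<exists>N. V = sub_rtm (rename Inr \<Gamma>\<^sub>2) (map_rtm id Inl N) \<and>
      REq (RMeta H) N \<in> \<Gamma>\<^sub>1)"
    unfolding REq_rename_RMeta_iff by blast
  finally show ?thesis .
qed

text \<open>This reduces absorption of the first substitution by the second to a statement about
  \<open>inst_ctm\<close> and \<open>inst_rtm\<close>: the value of a metavariable in the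
  composition is its first value instantiated by the second substitution.\<close>

lemma subst_eq_comp_apartI:
  assumes s: "substitution ar \<Gamma>\<^sub>1" "substitution ar \<Gamma>\<^sub>2" and dom: "subst_dom \<Gamma>\<^sub>1 = subst_dom \<Gamma>\<^sub>2"
    and c: "\<And>H k. HCon H \<in> subst_dom \<Gamma>\<^sub>1 \<Longrightarrow>
      inst_ctm \<Gamma>\<^sub>1 \<Gamma>\<^sub>2 k (sub_ctm \<Gamma>\<^sub>1 (CMeta H)) = exp_ctm \<Gamma>\<^sub>2 k (sub_ctm \<Gamma>\<^sub>2 (CMeta H))"
    and r: "\<And>H k. HRec H \<in> subst_dom \<Gamma>\<^sub>1 \<Longrightarrow>
      inst_rtm \<Gamma>\<^sub>1 \<Gamma>\<^sub>2 k (sub_rtm \<Gamma>\<^sub>1 (RMeta H)) = exp_rtm \<Gamma>\<^sub>2 k (sub_rtm \<Gamma>\<^sub>2 (RMeta H))"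
  shows "subst_eq (subst_comp_apart \<Gamma>\<^sub>1 \<Gamma>\<^sub>2) \<Gamma>\<^sub>2"
proof -
  let ?\<Phi> = "subst_comp_apart \<Gamma>\<^sub>1 \<Gamma>\<^sub>2"
  have d: "subst_dom ?\<Phi> = subst_dom \<Gamma>\<^sub>1"
    unfolding subst_dom_def CEq_subst_comp_apart_iff[OF dom] REq_subst_comp_apart_iff[OF dom]
    by blast
  have "sub_ctm ?\<Phi> (CMeta H) =
      sub_ctm (rename Inr \<Gamma>\<^sub>2) (map_ctm id id Inl (sub_ctm \<Gamma>\<^sub>1 (CMeta H)))"
    if H: "HCon H \<in> subst_dom \<Gamma>\<^sub>1" for H
  proof -
    have "(THE V. CEq (CMeta H) V \<in> ?\<Phi>) =
        sub_ctm (rename Inr \<Gamma>\<^sub>2) (map_ctm id id Inl (sub_ctm \<Gamma>\<^sub>1 (CMeta H)))"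
      unfolding CEq_subst_comp_apart_iff[OF dom]
      using sub_CMeta_mem[OF s(1) H] sub_CMeta_eq[OF s(1)] by (intro the_equality) blast+
    then show ?thesis using H d by simp
  qed
  moreover have "sub_rtm ?\<Phi> (RMeta H) =
      sub_rtm (rename Inr \<Gamma>\<^sub>2) (map_rtm id Inl (sub_rtm \<Gamma>\<^sub>1 (RMeta H)))"
    if H: "HRec H \<in> subst_dom \<Gamma>\<^sub>1" for H
  proof -
    have "(THE V. REq (RMeta H) V \<in> ?\<Phi>) =
        sub_rtm (rename Inr \<Gamma>\<^sub>2) (map_rtm id Inl (sub_rtm \<Gamma>\<^sub>1 (RMeta H)))"
      unfolding REq_subst_comp_apart_iff[OF dom]
      using sub_RMeta_mem[OF s(1) H] sub_RMeta_eq[OF s(1)] by (intro the_equality) blast+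
    then show ?thesis using H d by simp
  qed
  ultimately show ?thesis
    using c r dom d unfolding subst_eq_def exp_subst_comp_apart inst_ctm_def inst_rtm_def
    by simp
qed


section \<open>The constructed substitution\<close>

text \<open>The loop may stop after zero, one or two rounds; if it stops early, the remaining rounds
  would change nothing, so the result is the same.\<close>

lemma while_two:
  assumes "\<not> P (b (b s))" and "\<not> P s \<Longrightarrow> b s = s" and "\<not> P (b s) \<Longrightarrow> b (b s) = b s"
  shows "while P b s = b (b s)"
  using assms by (metis while_unfold)

locale unif_choice =
  fixes ar :: "'c \<Rightarrow> nat"
    and \<Delta> :: "('c, 'h, 'r) ctx"
    and cres :: "'h \<Rightarrow> ('c, 'h, 'r) ctm"
    and rres :: "'h \<Rightarrow> ('h, 'r) rtm"
    and crep rrep :: "'h \<Rightarrow> 'h"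
  assumes ctx: "unif_ctx ar \<Delta>"
    and sat: "saturated \<Delta>"
    and no_contra: "Contra \<notin> \<Delta>"
    and choice: "valid_choice \<Delta> cres rres crep rrep"
begin

section \<open>Consequences of saturation; resolutions and representatives\<close>

lemma derives_mem: "derives \<Delta> i \<Longrightarrow> i \<in> \<Delta>"
  using sat by (simp add: saturated_def)

lemma CEq_sym: "CEq U V \<in> \<Delta> \<Longrightarrow> CEq V U \<in> \<Delta>"
  by (rule derives_mem[OF derives.c_sym])

lemma CEq_trans: "CEq U V \<in> \<Delta> \<Longrightarrow> CEq V W \<in> \<Delta> \<Longrightarrow> CEq U W \<in> \<Delta>"
  by (rule derives_mem[OF derives.c_trans])

lemma REq_sym: "REq U V \<in> \<Delta> \<Longrightarrow> REq V U \<in> \<Delta>"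
  by (rule derives_mem[OF derives.r_sym])

lemma REq_trans: "REq U V \<in> \<Delta> \<Longrightarrow> REq V W \<in> \<Delta> \<Longrightarrow> REq U W \<in> \<Delta>"
  by (rule derives_mem[OF derives.r_trans])

lemma arity_item: "i \<in> \<Delta> \<Longrightarrow> arity_item ar i"
  using ctx by (simp add: unif_ctx_def)

lemma arity_CEq: "CEq U V \<in> \<Delta> \<Longrightarrow> arity_ctm ar U \<and> arity_ctm ar V"
  by (drule arity_item) simp

lemma arity_Def: "Def r U \<in> \<Delta> \<Longrightarrow> arity_ctm ar U"
  by (drule arity_item) simp

text \<open>A clash of constructors would put \<open>Contra\<close> into \<Delta>. The rule
  \<open>simp\<close> reaches only indices below both lengths; the common arity ensures that these
  are all indices.\<close>

lemma CEq_Con: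
  assumes "CEq (Con c Ns) (Con d Ns') \<in> \<Delta>"
  shows "c = d" "list_all2 (\<lambda>N N'. REq N N' \<in> \<Delta>) Ns Ns'"
proof -
  show "c = d"
    using derives_mem[OF derives.simp_f[OF assms]] no_contra by blast
  moreover have "length Ns = ar c" "length Ns' = ar d"
    using arity_CEq[OF assms] by simp_all
  ultimately have "length Ns = length Ns'" by simp
  then show "list_all2 (\<lambda>N N'. REq N N' \<in> \<Delta>) Ns Ns'"
    using derives_mem[OF derives.simp[OF assms[folded \<open>c = d\<close>]]]
    by (auto simp: list_all2_conv_all_nth)
qed

lemma REq_RConst:
  "REq (RConst r) (RConst s) \<in> \<Delta> \<Longrightarrow> Def r U \<in> \<Delta> \<Longrightarrow> Def s V \<in> \<Delta> \<Longrightarrow> CEq U V \<in> \<Delta>"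
  by (rule derives_mem[OF derives.r_exp])

lemma c_resolution_iff: "c_resolution \<Delta> H U \<longleftrightarrow> (\<exists>c Ns. U = Con c Ns) \<and> CEq (CMeta H) U \<in> \<Delta>"
  unfolding c_resolution_def using CEq_sym by blast

lemma r_resolution_iff: "r_resolution \<Delta> H N \<longleftrightarrow> (\<exists>r. N = RConst r) \<and> REq (RMeta H) N \<in> \<Delta>"
  unfolding r_resolution_def using REq_sym by blast

lemma cres: "H \<in> c_resolved \<Delta> \<Longrightarrow> \<exists>c Ns. cres H = Con c Ns \<and> CEq (CMeta H) (Con c Ns) \<in> \<Delta>"
  using choice unfolding valid_choice_def c_resolution_iff by fastforce

lemma rres: "H \<in> r_resolved \<Delta> \<Longrightarrow> \<exists>r. rres H = RConst r \<and> REq (RMeta H) (RConst r) \<in> \<Delta>"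
  using choice unfolding valid_choice_def r_resolution_iff by fastforce

lemma UV_CEq: "CEq U V \<in> \<Delta> \<Longrightarrow> uv_ctm U \<union> uv_ctm V \<subseteq> UV \<Delta>"
  unfolding UV_def by fastforce

lemma UV_REq: "REq N N' \<in> \<Delta> \<Longrightarrow> uv_rtm N \<union> uv_rtm N' \<subseteq> UV \<Delta>"
  unfolding UV_def by fastforce

lemma UV_Def: "Def r U \<in> \<Delta> \<Longrightarrow> uv_ctm U \<subseteq> UV \<Delta>"
  unfolding UV_def by fastforce

lemma c_resolvedI: "CEq (CMeta H) (Con c Ns) \<in> \<Delta> \<Longrightarrow> H \<in> c_resolved \<Delta>"
  using UV_CEq[of "CMeta H"] unfolding c_resolved_def c_resolution_iff by auto

lemma r_resolvedI: "REq (RMeta H) (RConst r) \<in> \<Delta> \<Longrightarrow> H \<in> r_resolved \<Delta>"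
  using UV_REq[of "RMeta H"] unfolding r_resolved_def r_resolution_iff by auto

lemma c_unresolvedI: "HCon H \<in> UV \<Delta> \<Longrightarrow> H \<notin> c_resolved \<Delta> \<Longrightarrow> H \<in> c_unresolved \<Delta>"
  by (simp add: c_unresolved_def)

lemma r_unresolvedI: "HRec H \<in> UV \<Delta> \<Longrightarrow> H \<notin> r_resolved \<Delta> \<Longrightarrow> H \<in> r_unresolved \<Delta>"
  by (simp add: r_unresolved_def)

text \<open>The generating equations relate only unresolved metavariables, but the closure is
  reflexive on all names; hence the assumption on \<open>H\<close>.\<close>

lemma c_equiv_unresolved:
  "(H, G) \<in> c_equiv \<Delta> \<Longrightarrow> H \<in> c_unresolved \<Delta> \<Longrightarrow> G \<in> c_unresolved \<Delta>"
  unfolding c_equiv_def Let_def by (induction rule: rtrancl_induct) auto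

lemma r_equiv_unresolved:
  "(H, G) \<in> r_equiv \<Delta> \<Longrightarrow> H \<in> r_unresolved \<Delta> \<Longrightarrow> G \<in> r_unresolved \<Delta>"
  unfolding r_equiv_def Let_def by (induction rule: rtrancl_induct) auto

text \<open>This is used to carry an expansion under an arbitrary unifier from a metavariable to the
  representative of its class.\<close>

lemma c_equiv_invariant:
  assumes "(H, G) \<in> c_equiv \<Delta>" and "\<And>H G. CEq (CMeta H) (CMeta G) \<in> \<Delta> \<Longrightarrow> f H = f G"
  shows "f H = f G"
  using assms(1) unfolding c_equiv_def Let_def
  by (induction rule: rtrancl_induct) (auto dest: assms(2))

lemma r_equiv_invariant:
  assumes "(H, G) \<in> r_equiv \<Delta>" and "\<And>H G. REq (RMeta H) (RMeta G) \<in> \<Delta> \<Longrightarrow> f H = f G"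
  shows "f H = f G"
  using assms(1) unfolding r_equiv_def Let_def
  by (induction rule: rtrancl_induct) (auto dest: assms(2))

lemma crep:
  assumes "H \<in> c_unresolved \<Delta>"
  shows "(H, crep H) \<in> c_equiv \<Delta>" "crep H \<in> c_unresolved \<Delta>" "crep (crep H) = crep H"
proof -
  show 1: "(H, crep H) \<in> c_equiv \<Delta>"
    using assms choice unfolding valid_choice_def by blast
  show 2: "crep H \<in> c_unresolved \<Delta>" by (rule c_equiv_unresolved[OF 1 assms])
  have "\<forall>H\<in>c_unresolved \<Delta>. \<forall>G\<in>c_unresolved \<Delta>. (H, G) \<in> c_equiv \<Delta> \<longrightarrow> crep H = crep G"
    using choice unfolding valid_choice_def by blast
  then show "crep (crep H) = crep H" using 1 2 assms by metis
qed

lemma rrep: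
  assumes "H \<in> r_unresolved \<Delta>"
  shows "(H, rrep H) \<in> r_equiv \<Delta>" "rrep H \<in> r_unresolved \<Delta>" "rrep (rrep H) = rrep H"
proof -
  show 1: "(H, rrep H) \<in> r_equiv \<Delta>"
    using assms choice unfolding valid_choice_def by blast
  show 2: "rrep H \<in> r_unresolved \<Delta>" by (rule r_equiv_unresolved[OF 1 assms])
  have "\<forall>H\<in>r_unresolved \<Delta>. \<forall>G\<in>r_unresolved \<Delta>. (H, G) \<in> r_equiv \<Delta> \<longrightarrow> rrep H = rrep G"
    using choice unfolding valid_choice_def by blast
  then show "rrep (rrep H) = rrep H" using 1 2 assms by metis
qed

lemma crep_eq:
  assumes "CEq (CMeta H) (CMeta G) \<in> \<Delta>" "H \<in> c_unresolved \<Delta>" "G \<in> c_unresolved \<Delta>"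
  shows "crep H = crep G"
proof -
  have "(H, G) \<in> c_equiv \<Delta>" using assms unfolding c_equiv_def Let_def by blast
  then show ?thesis using assms choice unfolding valid_choice_def by blast
qed

lemma rrep_eq:
  assumes "REq (RMeta H) (RMeta G) \<in> \<Delta>" "H \<in> r_unresolved \<Delta>" "G \<in> r_unresolved \<Delta>"
  shows "rrep H = rrep G"
proof -
  have "(H, G) \<in> r_equiv \<Delta>" using assms unfolding r_equiv_def Let_def by blast
  then show ?thesis using assms choice unfolding valid_choice_def by blast
qed

section \<open>One and two rounds of replacement on terms\<close>

definition step_r :: "('h, 'r) rtm \<Rightarrow> ('h, 'r) rtm" where
  "step_r N = (case N of RConst r \<Rightarrow> RConst r
     | RMeta H \<Rightarrow> if H \<in> r_resolved \<Delta> then rres H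
         else if H \<in> r_unresolved \<Delta> then RMeta (rrep H) else RMeta H)"

text \<open>The case distinction avoids the definite descriptions of \<open>sub_ctm\<close>;
  \<open>sub_c_unif_start\<close> shows that it is application of \<open>unif_start\<close>. The
  last branch covers metavariables outside \<open>UV \<Delta>\<close>.\<close>

definition step_c :: "('c, 'h, 'r) ctm \<Rightarrow> ('c, 'h, 'r) ctm" where
  "step_c U = (case U of Con c Ns \<Rightarrow> Con c (map step_r Ns)
     | CMeta H \<Rightarrow> if H \<in> c_resolved \<Delta> then cres H
         else if H \<in> c_unresolved \<Delta> then CMeta (crep H) else CMeta H)"

text \<open>Replacing a resolved metavariable exposes the arguments of its resolution, and a second round
  reduces these to constants and representatives.\<close>

abbreviation norm_c :: "('c, 'h, 'r) ctm \<Rightarrow> ('c, 'h, 'r) ctm" where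
  "norm_c U \<equiv> step_c (step_c U)"

lemma step_r_simps [simp]:
  "step_r (RConst r) = RConst r"
  "H \<in> r_resolved \<Delta> \<Longrightarrow> step_r (RMeta H) = rres H"
  "H \<in> r_unresolved \<Delta> \<Longrightarrow> step_r (RMeta H) = RMeta (rrep H)"
  by (auto simp: step_r_def r_unresolved_def)

lemma step_r_rres [simp]: "H \<in> r_resolved \<Delta> \<Longrightarrow> step_r (rres H) = rres H"
  by (auto dest: rres)

lemma step_c_simps [simp]:
  "step_c (Con c Ns) = Con c (map step_r Ns)"
  "H \<in> c_resolved \<Delta> \<Longrightarrow> step_c (CMeta H) = cres H"
  "H \<in> c_unresolved \<Delta> \<Longrightarrow> step_c (CMeta H) = CMeta (crep H)"
  by (auto simp: step_c_def c_unresolved_def)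

lemma rmeta_cases:
  assumes "HRec H \<in> UV \<Delta>"
  obtains "H \<in> r_resolved \<Delta>" | "H \<in> r_unresolved \<Delta>"
  using assms r_unresolvedI by blast

lemma cmeta_cases:
  assumes "HCon H \<in> UV \<Delta>"
  obtains "H \<in> c_resolved \<Delta>" | "H \<in> c_unresolved \<Delta>"
  using assms c_unresolvedI by blast

text \<open>One round suffices for recursive terms: resolutions are constants, and a representative
  represents itself.\<close>

lemma step_r_idem: "uv_rtm N \<subseteq> UV \<Delta> \<Longrightarrow> step_r (step_r N) = step_r N"
  by (cases N) (auto elim!: rmeta_cases simp: rrep)

text \<open>The condition on metavariables is the exit condition of the loop; the condition on
  constants serves to show that the result is a well-formed context. \<open>reduced_c\<close> adds
  the arities.\<close>

definition reduced_r :: "('h, 'r) rtm \<Rightarrow> bool" where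
  "reduced_r N \<longleftrightarrow> rconsts_rtm N \<subseteq> defined \<Delta> \<and> uv_rtm N \<subseteq> representatives \<Delta> crep rrep"

lemma step_r_reduced:
  assumes "rconsts_rtm N \<subseteq> defined \<Delta>" "uv_rtm N \<subseteq> UV \<Delta>"
  shows "reduced_r (step_r N)"
proof (cases N)
  case (RMeta H)
  then have "HRec H \<in> UV \<Delta>" using assms by simp
  then show ?thesis
  proof (cases rule: rmeta_cases)
    case 1
    then show ?thesis using rres[OF 1] rconsts_REq(2)[OF ctx] RMeta
      by (fastforce simp: reduced_r_def)
  next
    case 2
    then show ?thesis using RMeta by (auto simp: reduced_r_def representatives_def)
  qed
qed (use assms in \<open>simp add: reduced_r_def\<close>)

definition reduced_c :: "('c, 'h, 'r) ctm \<Rightarrow> bool" where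
  "reduced_c U \<longleftrightarrow> arity_ctm ar U \<and> rconsts_ctm U \<subseteq> defined \<Delta> \<and>
     uv_ctm U \<subseteq> representatives \<Delta> crep rrep"

lemma reduced_Con_step:
  assumes "arity_ctm ar (Con c Ns)" "rconsts_ctm (Con c Ns) \<subseteq> defined \<Delta>" "uv_ctm (Con c Ns) \<subseteq> UV \<Delta>"
  shows "reduced_c (Con c (map step_r Ns))" "map step_r (map step_r Ns) = map step_r Ns"
proof -
  have N: "rconsts_rtm N \<subseteq> defined \<Delta>" "uv_rtm N \<subseteq> UV \<Delta>" if "N \<in> set Ns" for N
    using that assms by auto
  show "reduced_c (Con c (map step_r Ns))"
    using assms(1) step_r_reduced[OF N] by (auto simp: reduced_c_def reduced_r_def)
  show "map step_r (map step_r Ns) = map step_r Ns"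
    using step_r_idem[OF N(2)] by simp
qed

text \<open>The first round exposes the resolution and the second steps its arguments. Starting from
  the resolution, the second round is idle by idempotence, so both starting points reach the same
  normal form.\<close>

lemma norm_c_cres:
  assumes "H \<in> c_resolved \<Delta>"
  shows "\<exists>c Ns. cres H = Con c Ns \<and> CEq (CMeta H) (Con c Ns) \<in> \<Delta> \<and>
    norm_c (CMeta H) = Con c (map step_r Ns) \<and> norm_c (Con c Ns) = Con c (map step_r Ns) \<and>
    reduced_c (Con c (map step_r Ns))"
proof -
  obtain c Ns where 1: "cres H = Con c Ns" "CEq (CMeta H) (Con c Ns) \<in> \<Delta>"
    using cres[OF assms] by blast
  have "arity_ctm ar (Con c Ns)" "rconsts_ctm (Con c Ns) \<subseteq> defined \<Delta>" "uv_ctm (Con c Ns) \<subseteq> UV \<Delta>"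
    using arity_CEq[OF 1(2)] rconsts_CEq(2)[OF ctx 1(2)] UV_CEq[OF 1(2)] by blast+
  from reduced_Con_step[OF this] show ?thesis using 1 assms by simp
qed

lemma norm_c_unresolved: "H \<in> c_unresolved \<Delta> \<Longrightarrow> norm_c (CMeta H) = CMeta (crep H)"
  by (simp add: crep)

lemma norm_c_Con:
  assumes "uv_ctm (Con c Ns) \<subseteq> UV \<Delta>"
  shows "norm_c (Con c Ns) = Con c (map step_r Ns)"
  using assms by (auto simp: UN_subset_iff intro!: step_r_idem)

lemma norm_c_reduced:
  assumes "arity_ctm ar U" "rconsts_ctm U \<subseteq> defined \<Delta>" "uv_ctm U \<subseteq> UV \<Delta>"
  shows "reduced_c (norm_c U)"
proof (cases U)
  case (Con c Ns)
  then show ?thesis using assms by (simp only: norm_c_Con reduced_Con_step(1))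
next
  case (CMeta H)
  then have "HCon H \<in> UV \<Delta>" using assms by simp
  then show ?thesis
  proof (cases rule: cmeta_cases)
    case 1
    then show ?thesis using norm_c_cres[OF 1] CMeta by auto
  next
    case 2
    then have "norm_c U = CMeta (crep H)" using CMeta norm_c_unresolved by simp
    then show ?thesis using 2 by (auto simp: reduced_c_def representatives_def)
  qed
qed

section \<open>Closed form of the replacement loop\<close>

lemma step_r_rep: "uv_rtm N \<subseteq> representatives \<Delta> crep rrep \<Longrightarrow> step_r N = N"
  by (cases N) (auto simp: representatives_def rrep)

lemma step_c_rep: "uv_ctm U \<subseteq> representatives \<Delta> crep rrep \<Longrightarrow> step_c U = U"
proof (cases U)
  case (Con c Ns)
  assume "uv_ctm U \<subseteq> representatives \<Delta> crep rrep"
  then show ?thesis using Con by (auto simp: UN_subset_iff intro!: map_idI step_r_rep)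
qed (auto simp: representatives_def crep)

text \<open>One format for all iterates of the loop. Values and definition bodies get separate
  functions \<open>f\<close> and \<open>h\<close> because the bodies lag one round behind.\<close>

definition shaped :: "(('c, 'h, 'r) ctm \<Rightarrow> ('c, 'h, 'r) ctm) \<Rightarrow>
    (('h, 'r) rtm \<Rightarrow> ('h, 'r) rtm) \<Rightarrow> (('c, 'h, 'r) ctm \<Rightarrow> ('c, 'h, 'r) ctm) \<Rightarrow> ('c, 'h, 'r) ctx" where
  "shaped f g h = {CEq (CMeta H) (f (CMeta H)) | H. HCon H \<in> UV \<Delta>} \<union>
     {REq (RMeta H) (g (RMeta H)) | H. HRec H \<in> UV \<Delta>} \<union> {Def r (h U) | r U. Def r U \<in> \<Delta>}"

lemma shaped_iff [simp]:
  "CEq V U \<in> shaped f g h \<longleftrightarrow> (\<exists>H. V = CMeta H \<and> U = f (CMeta H) \<and> HCon H \<in> UV \<Delta>)"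
  "REq W N \<in> shaped f g h \<longleftrightarrow> (\<exists>H. W = RMeta H \<and> N = g (RMeta H) \<and> HRec H \<in> UV \<Delta>)"
  "Def r B \<in> shaped f g h \<longleftrightarrow> (\<exists>U. B = h U \<and> Def r U \<in> \<Delta>)"
  "Contra \<notin> shaped f g h"
  by (auto simp: shaped_def)

lemma subst_dom_shaped: "subst_dom (shaped f g h) = UV \<Delta>"
proof (intro set_eqI)
  fix x show "x \<in> subst_dom (shaped f g h) \<longleftrightarrow> x \<in> UV \<Delta>"
    by (cases x) (auto simp: subst_dom_def)
qed

lemma unif_start_eq: "unif_start \<Delta> cres rres crep rrep = shaped step_c step_r (\<lambda>U. U)"
proof (intro set_eqI)
  fix i
  have c: "HCon H \<in> UV \<Delta> \<longleftrightarrow> H \<in> c_resolved \<Delta> \<or> H \<in> c_unresolved \<Delta>"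
    and r: "HRec H \<in> UV \<Delta> \<longleftrightarrow> H \<in> r_resolved \<Delta> \<or> H \<in> r_unresolved \<Delta>" for H
    by (auto simp: c_resolved_def c_unresolved_def r_resolved_def r_unresolved_def)
  show "i \<in> unif_start \<Delta> cres rres crep rrep \<longleftrightarrow> i \<in> shaped step_c step_r (\<lambda>U. U)"
    by (cases i) (auto simp: unif_start_def defs_def c r)
qed

lemma sub_r_unif_start: "sub_rtm (unif_start \<Delta> cres rres crep rrep) N = step_r N"
proof (cases N)
  case (RMeta H)
  then show ?thesis
    unfolding unif_start_eq
    by (auto simp: subst_dom_shaped step_r_def r_resolved_def r_unresolved_def)
qed simp

lemma sub_c_unif_start: "sub_ctm (unif_start \<Delta> cres rres crep rrep) U = step_c U"
proof (cases U)
  case (CMeta H)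
  then show ?thesis
    unfolding unif_start_eq
    by (auto simp: subst_dom_shaped step_c_def c_resolved_def c_unresolved_def)
qed (simp add: sub_r_unif_start)

lemma rhs_sub_shaped:
  "rhs_sub (shaped f g h) (unif_start \<Delta> cres rres crep rrep) =
    shaped (\<lambda>U. step_c (f U)) (\<lambda>N. step_r (g N)) (\<lambda>U. step_c (h U))"
proof (intro set_eqI)
  fix i
  show "i \<in> rhs_sub (shaped f g h) (unif_start \<Delta> cres rres crep rrep) \<longleftrightarrow>
      i \<in> shaped (\<lambda>U. step_c (f U)) (\<lambda>N. step_r (g N)) (\<lambda>U. step_c (h U))"
    by (cases i) (auto simp: rhs_sub_def sub_r_unif_start sub_c_unif_start)
qed

lemma rhs_uv_shaped:
  "rhs_uv (shaped f g h) =
     (\<Union>H\<in>{H. HCon H \<in> UV \<Delta>}. uv_ctm (f (CMeta H))) \<union>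
     (\<Union>H\<in>{H. HRec H \<in> UV \<Delta>}. uv_rtm (g (RMeta H))) \<union>
     (\<Union>U\<in>{U. \<exists>r. Def r U \<in> \<Delta>}. uv_ctm (h U))"
  unfolding rhs_uv_def shaped_iff by (intro arg_cong2[where f = "(\<union>)"]) blast+

lemma shaped_cong:
  assumes "\<And>H. HCon H \<in> UV \<Delta> \<Longrightarrow> f (CMeta H) = f' (CMeta H)"
    and "\<And>H. HRec H \<in> UV \<Delta> \<Longrightarrow> g (RMeta H) = g' (RMeta H)"
    and "\<And>r U. Def r U \<in> \<Delta> \<Longrightarrow> h U = h' U"
  shows "shaped f g h = shaped f' g' h'"
  unfolding shaped_def
  by (intro arg_cong2[where f = "(\<union>)"] Collect_cong) (metis assms)+

text \<open>Under the exit condition all right-hand sides mention only representatives, which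
  \<open>step_c\<close> and \<open>step_r\<close> fix. This supplies the stability assumptions of
  \<open>while_two\<close>.\<close>

lemma rhs_sub_shaped_fix:
  assumes "rhs_uv (shaped f g h) \<subseteq> representatives \<Delta> crep rrep"
  shows "rhs_sub (shaped f g h) (unif_start \<Delta> cres rres crep rrep) = shaped f g h"
  unfolding rhs_sub_shaped using assms unfolding rhs_uv_shaped
  by (intro shaped_cong step_c_rep step_r_rep) blast+

lemma step_c_norm_c_CMeta:
  assumes "HCon H \<in> UV \<Delta>"
  shows "step_c (norm_c (CMeta H)) = norm_c (CMeta H)"
proof -
  have "reduced_c (norm_c (CMeta H))" using assms by (intro norm_c_reduced) auto
  then show ?thesis by (intro step_c_rep) (simp add: reduced_c_def)
qed

lemma unif_eq: "unif \<Delta> cres rres crep rrep = shaped norm_c step_r norm_c"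
proof -
  let ?\<Gamma>\<^sub>0 = "unif_start \<Delta> cres rres crep rrep"
  let ?P = "\<lambda>\<Gamma>. \<not> rhs_uv \<Gamma> \<subseteq> representatives \<Delta> crep rrep"
  \<comment> \<open>Values in \<open>unif_start\<close> have already made one step and bodies none,
    so this round completes the values but leaves the bodies one step short.\<close>
  have 1: "rhs_sub ?\<Gamma>\<^sub>0 ?\<Gamma>\<^sub>0 = shaped norm_c (\<lambda>N. step_r (step_r N)) step_c"
    by (subst (1) unif_start_eq) (rule rhs_sub_shaped)
  \<comment> \<open>The second round completes the bodies; the surplus steps on values collapse by
    stability and idempotence.\<close>
  have 2: "rhs_sub (rhs_sub ?\<Gamma>\<^sub>0 ?\<Gamma>\<^sub>0) ?\<Gamma>\<^sub>0 = shaped norm_c step_r norm_c"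
    unfolding 1 rhs_sub_shaped
    by (intro shaped_cong) (auto simp: step_c_norm_c_CMeta step_r_idem)
  have "reduced_c (norm_c (CMeta H))" if "HCon H \<in> UV \<Delta>" for H
    using that by (intro norm_c_reduced) auto
  moreover have "reduced_r (step_r (RMeta H))" if "HRec H \<in> UV \<Delta>" for H
    using that by (intro step_r_reduced) auto
  moreover have "reduced_c (norm_c U)" if "Def r U \<in> \<Delta>" for r U
    using arity_Def[OF that] rconsts_Def[OF ctx that] UV_Def[OF that] by (intro norm_c_reduced)
  ultimately have "\<not> ?P (shaped norm_c step_r norm_c)"
    unfolding rhs_uv_shaped reduced_c_def reduced_r_def by blast
  then have "\<not> ?P (rhs_sub (rhs_sub ?\<Gamma>\<^sub>0 ?\<Gamma>\<^sub>0) ?\<Gamma>\<^sub>0)" unfolding 2 .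
  moreover have "rhs_sub \<Gamma> ?\<Gamma>\<^sub>0 = \<Gamma>" if "\<not> ?P \<Gamma>" "\<Gamma> = shaped f g h" for \<Gamma> f g h
    using that rhs_sub_shaped_fix by simp
  moreover note 1
  ultimately have "while ?P (\<lambda>\<Gamma>. rhs_sub \<Gamma> ?\<Gamma>\<^sub>0) ?\<Gamma>\<^sub>0 = rhs_sub (rhs_sub ?\<Gamma>\<^sub>0 ?\<Gamma>\<^sub>0) ?\<Gamma>\<^sub>0"
    using unif_start_eq by (intro while_two) blast+
  then show ?thesis unfolding unif_def Let_def 2 .
qed

section \<open>The normal form as a substitution\<close>

abbreviation mgu :: "('c, 'h, 'r) ctx" where
  "mgu \<equiv> shaped norm_c step_r norm_c"

lemma defined_mgu: "defined mgu = defined \<Delta>"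
  by (auto simp: defined_def)

lemma finite_UV: "finite (UV \<Delta>)"
proof -
  have "finite (uv_rtm N)" for N :: "('h, 'r) rtm" by (cases N) auto
  moreover from this have "finite (uv_ctm U)" for U :: "('c, 'h, 'r) ctm" by (cases U) auto
  ultimately have "finite (uv_item i)" for i :: "('c, 'h, 'r) item" by (cases i) auto
  then show ?thesis using ctx unfolding UV_def unif_ctx_def by blast
qed

lemma finite_mgu: "finite mgu"
proof -
  let ?f = "\<lambda>x. case x of HCon H \<Rightarrow> CEq (CMeta H) (norm_c (CMeta H))
    | HRec H \<Rightarrow> REq (RMeta H) (step_r (RMeta H))"
  \<comment> \<open>\<open>?g\<close> is unspecified on items other than definitions, which is
    harmless because only an inclusion of \<open>mgu\<close> in the two images is claimed.\<close>
  let ?g = "\<lambda>i. case i of Def r U \<Rightarrow> Def r (norm_c U)"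
  have "i \<in> ?f ` UV \<Delta> \<union> ?g ` \<Delta>" if "i \<in> mgu" for i
    using that unfolding shaped_def by (auto intro: rev_image_eqI)
  then have "mgu \<subseteq> ?f ` UV \<Delta> \<union> ?g ` \<Delta>" by blast
  moreover have "finite \<Delta>" using ctx by (simp add: unif_ctx_def)
  ultimately show ?thesis using finite_UV by (meson finite_UnI finite_imageI finite_subset)
qed

lemma mgu_reduced:
  "HCon H \<in> UV \<Delta> \<Longrightarrow> reduced_c (norm_c (CMeta H))"
  "HRec H \<in> UV \<Delta> \<Longrightarrow> reduced_r (step_r (RMeta H))"
  "Def r U \<in> \<Delta> \<Longrightarrow> reduced_c (norm_c U)"
  by (rule norm_c_reduced step_r_reduced; auto)+
    (rule norm_c_reduced[OF arity_Def rconsts_Def[OF ctx] UV_Def])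

lemma substitution_mgu: "substitution ar mgu"
proof -
  have "arity_item ar i \<and> rconsts_item i \<subseteq> defined mgu" if "i \<in> mgu" for i
  proof (cases i)
    case (CEq V U)
    then obtain H where "V = CMeta H" "U = norm_c (CMeta H)" "HCon H \<in> UV \<Delta>"
      using \<open>i \<in> mgu\<close> by auto
    with mgu_reduced(1)[of H] CEq show ?thesis by (auto simp: reduced_c_def defined_mgu)
  next
    case (REq W N)
    then obtain H where "W = RMeta H" "N = step_r (RMeta H)" "HRec H \<in> UV \<Delta>"
      using \<open>i \<in> mgu\<close> by auto
    with mgu_reduced(2)[of H] REq show ?thesis by (auto simp: reduced_r_def defined_mgu)
  next
    case (Def r B)
    then obtain U where "B = norm_c U" "Def r U \<in> \<Delta>"
      using \<open>i \<in> mgu\<close> by auto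
    with mgu_reduced(3)[OF this(2)] Def show ?thesis
      by (auto simp: reduced_c_def defined_mgu) (auto simp: defined_def)
  qed auto
  moreover have "U = U'" if "Def r U \<in> mgu" "Def r U' \<in> mgu" for r U U'
    using that ctx unfolding unif_ctx_def by auto
  ultimately have "unif_ctx ar mgu"
    using finite_mgu unfolding unif_ctx_def defined_def by blast
  then show ?thesis unfolding substitution_def by auto
qed

lemma sub_mgu:
  "HCon H \<in> UV \<Delta> \<Longrightarrow> sub_ctm mgu (CMeta H) = norm_c (CMeta H)"
  "HRec H \<in> UV \<Delta> \<Longrightarrow> sub_rtm mgu (RMeta H) = step_r (RMeta H)"
  by (auto simp: subst_dom_shaped)

lemma body_mgu: "Def r U \<in> \<Delta> \<Longrightarrow> body mgu r = norm_c U"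
  using substitution_mgu by (intro body_eq[of ar]) (auto simp: substitution_def)

section \<open>Unification and generality\<close>

text \<open>Replacement before expansion agrees with instantiation during expansion: the bodies in
  \<open>mgu\<close> are already normalised, and at a metavariable both sides expand its value in
  \<open>mgu\<close>.\<close>

lemma exp_norm:
  "rconsts_ctm U \<subseteq> defined \<Delta> \<Longrightarrow> uv_ctm U \<subseteq> UV \<Delta> \<Longrightarrow>
     exp_ctm mgu k (norm_c U) = inst_ctm \<Delta> mgu k U"
  "rconsts_rtm N \<subseteq> defined \<Delta> \<Longrightarrow> uv_rtm N \<subseteq> UV \<Delta> \<Longrightarrow>
     exp_rtm mgu k (step_r N) = inst_rtm \<Delta> mgu k N"
proof (induction k arbitrary: U N)
  case (Suc k)
  { case (1 U)
    show ?case
    proof (cases U)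
      case (Con c Ns)
      have "exp_rtm mgu k (step_r N) = inst_rtm \<Delta> mgu k N" if "N \<in> set Ns" for N
        using that 1 Con by (intro Suc(2)) auto
      then show ?thesis using norm_c_Con[of c Ns] 1 Con by (simp add: inst_Con)
    next
      case (CMeta H)
      then show ?thesis
        using 1 by (simp add: inst_CMeta[OF substitution_mgu] sub_mgu(1) del: sub_ctm.simps)
    qed }
  note c = this
  { case (2 N)
    show ?case
    proof (cases N)
      case (RConst r)
      then obtain U where U: "Def r U \<in> \<Delta>" using 2 by (auto simp: defined_def)
      then show ?thesis
        using RConst c[OF rconsts_Def[OF ctx U] UV_Def[OF U]] body_mgu[OF U]
        by (simp add: inst_RConst[OF ctx U])
    next
      case (RMeta H)
      then show ?thesis
        using 2 by (simp add: inst_RMeta[OF substitution_mgu] sub_mgu(2) del: sub_rtm.simps)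
    qed }
qed auto

text \<open>Both terms have the same normal form, so \<open>exp_norm\<close> gives equal expansions
  before \<open>mgu\<close> is known to satisfy the equations of \<Delta>.\<close>

lemma inst_mgu_c_resolved:
  assumes "H \<in> c_resolved \<Delta>"
  shows "\<exists>c Ns. CEq (CMeta H) (Con c Ns) \<in> \<Delta> \<and>
    (\<forall>k. inst_ctm \<Delta> mgu k (CMeta H) = inst_ctm \<Delta> mgu k (Con c Ns))"
proof -
  obtain c Ns where 1: "CEq (CMeta H) (Con c Ns) \<in> \<Delta>" "norm_c (CMeta H) = norm_c (Con c Ns)"
    using norm_c_cres[OF assms] by metis
  show ?thesis
    using 1 exp_norm(1)[OF rconsts_CEq(1)[OF ctx 1(1)]] exp_norm(1)[OF rconsts_CEq(2)[OF ctx 1(1)]]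
      UV_CEq[OF 1(1)] by (metis le_sup_iff)
qed

lemma inst_mgu_r_resolved:
  assumes "H \<in> r_resolved \<Delta>"
  shows "\<exists>r. REq (RMeta H) (RConst r) \<in> \<Delta> \<and>
    (\<forall>k. inst_rtm \<Delta> mgu k (RMeta H) = inst_rtm \<Delta> mgu k (RConst r))"
proof -
  obtain r where 1: "REq (RMeta H) (RConst r) \<in> \<Delta>" "step_r (RMeta H) = step_r (RConst r)"
    using rres[OF assms] assms by auto
  show ?thesis
    using 1 exp_norm(2)[OF rconsts_REq(1)[OF ctx 1(1)]] exp_norm(2)[OF rconsts_REq(2)[OF ctx 1(1)]]
      UV_REq[OF 1(1)] by (metis le_sup_iff)
qed

text \<open>Each side is an unresolved metavariable or has a constructor form. Mixed pairs cannot
  occur, since transitivity would resolve the metavariable, and two constructor forms are equated by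
  symmetry and transitivity.\<close>

lemma CEq_cases:
  assumes "CEq U V \<in> \<Delta>"
  obtains (unresolved) H G where "U = CMeta H" "V = CMeta G"
      "H \<in> c_unresolved \<Delta>" "G \<in> c_unresolved \<Delta>" "crep H = crep G"
  | (resolved) c Ns Ns' where "CEq (Con c Ns) (Con c Ns') \<in> \<Delta>"
      "\<And>k. inst_ctm \<Delta> mgu k U = inst_ctm \<Delta> mgu k (Con c Ns)"
      "\<And>k. inst_ctm \<Delta> mgu k V = inst_ctm \<Delta> mgu k (Con c Ns')"
proof -
  have reduct: "(\<exists>H. W = CMeta H \<and> H \<in> c_unresolved \<Delta>) \<or>
      (\<exists>c Ns. (W = Con c Ns \<or> CEq W (Con c Ns) \<in> \<Delta>) \<and>
        (\<forall>k. inst_ctm \<Delta> mgu k W = inst_ctm \<Delta> mgu k (Con c Ns)))"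
    if "uv_ctm W \<subseteq> UV \<Delta>" for W
    using that inst_mgu_c_resolved by (cases W) (auto elim!: cmeta_cases)
  have UV: "uv_ctm U \<subseteq> UV \<Delta>" "uv_ctm V \<subseteq> UV \<Delta>" using UV_CEq[OF assms] by auto
  \<comment> \<open>\<open>W\<close> either is a constructor term or is equated with one; in both
    cases \<open>H\<close> would be resolved.\<close>
  have *: False if "CEq (CMeta H) W \<in> \<Delta>" "W = Con c Ns \<or> CEq W (Con c Ns) \<in> \<Delta>"
    "H \<in> c_unresolved \<Delta>" for H W c Ns
    using that CEq_trans c_resolvedI unfolding c_unresolved_def by blast
  from reduct[OF UV(1)] consider (u) H where "U = CMeta H" "H \<in> c_unresolved \<Delta>"
    | (r) c Ns where "U = Con c Ns \<or> CEq U (Con c Ns) \<in> \<Delta>"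
      "\<forall>k. inst_ctm \<Delta> mgu k U = inst_ctm \<Delta> mgu k (Con c Ns)" by blast
  then show thesis
  proof cases
    case (u H)
    from reduct[OF UV(2)] show thesis
      using u * assms crep_eq unresolved by blast
  next
    case U: (r c Ns)
    from reduct[OF UV(2)] consider "\<exists>H. V = CMeta H \<and> H \<in> c_unresolved \<Delta>"
      | d Ns' where "V = Con d Ns' \<or> CEq V (Con d Ns') \<in> \<Delta>"
        "\<forall>k. inst_ctm \<Delta> mgu k V = inst_ctm \<Delta> mgu k (Con d Ns')" by blast
    then show thesis
    proof cases
      case 1
      then show thesis using * CEq_sym[OF assms] U(1) by blast
    next
      case 2
      then have "CEq (Con c Ns) (Con d Ns') \<in> \<Delta>"
        using U(1) assms CEq_sym CEq_trans by metis
      with CEq_Con(1)[OF this] show thesis using resolved U(2) 2(2) by blast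
    qed
  qed
qed

text \<open>The argument of \<open>CEq_cases\<close> with constants in place of constructor terms.
  Here \<open>r\<close> and \<open>s\<close> may differ, as equated constants are no
  contradiction.\<close>

lemma REq_cases:
  assumes "REq N N' \<in> \<Delta>"
  obtains (unresolved) H G where "N = RMeta H" "N' = RMeta G"
      "H \<in> r_unresolved \<Delta>" "G \<in> r_unresolved \<Delta>" "rrep H = rrep G"
  | (resolved) r s where "REq (RConst r) (RConst s) \<in> \<Delta>"
      "\<And>k. inst_rtm \<Delta> mgu k N = inst_rtm \<Delta> mgu k (RConst r)"
      "\<And>k. inst_rtm \<Delta> mgu k N' = inst_rtm \<Delta> mgu k (RConst s)"
proof -
  have reduct: "(\<exists>H. W = RMeta H \<and> H \<in> r_unresolved \<Delta>) \<or>
      (\<exists>r. (W = RConst r \<or> REq W (RConst r) \<in> \<Delta>) \<and>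
        (\<forall>k. inst_rtm \<Delta> mgu k W = inst_rtm \<Delta> mgu k (RConst r)))"
    if "uv_rtm W \<subseteq> UV \<Delta>" for W
    using that inst_mgu_r_resolved by (cases W) (auto elim!: rmeta_cases)
  have UV: "uv_rtm N \<subseteq> UV \<Delta>" "uv_rtm N' \<subseteq> UV \<Delta>" using UV_REq[OF assms] by auto
  have *: False if "REq (RMeta H) W \<in> \<Delta>" "W = RConst r \<or> REq W (RConst r) \<in> \<Delta>"
    "H \<in> r_unresolved \<Delta>" for H W r
    using that REq_trans r_resolvedI unfolding r_unresolved_def by blast
  from reduct[OF UV(1)] consider (u) H where "N = RMeta H" "H \<in> r_unresolved \<Delta>"
    | (r) r where "N = RConst r \<or> REq N (RConst r) \<in> \<Delta>"
      "\<forall>k. inst_rtm \<Delta> mgu k N = inst_rtm \<Delta> mgu k (RConst r)" by blast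
  then show thesis
  proof cases
    case (u H)
    from reduct[OF UV(2)] show thesis
      using u * assms rrep_eq unresolved by blast
  next
    case N: (r r)
    from reduct[OF UV(2)] consider "\<exists>H. N' = RMeta H \<and> H \<in> r_unresolved \<Delta>"
      | s where "N' = RConst s \<or> REq N' (RConst s) \<in> \<Delta>"
        "\<forall>k. inst_rtm \<Delta> mgu k N' = inst_rtm \<Delta> mgu k (RConst s)" by blast
    then show thesis
    proof cases
      case 1
      then show thesis using * REq_sym[OF assms] N(1) by blast
    next
      case 2
      then have "REq (RConst r) (RConst s) \<in> \<Delta>"
        using N(1) assms REq_sym REq_trans by metis
      then show thesis using resolved N(2) 2(2) by blast
    qed
  qed
qed

text \<open>Equations between constructor terms pass to their arguments at smaller depth. Equations
  between constants pass to their bodies at the same depth, where the contractive half is already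
  available.\<close>

lemma mgu_equations_hold:
  "CEq U V \<in> \<Delta> \<Longrightarrow> inst_ctm \<Delta> mgu k U = inst_ctm \<Delta> mgu k V"
  "REq N N' \<in> \<Delta> \<Longrightarrow> inst_rtm \<Delta> mgu k N = inst_rtm \<Delta> mgu k N'"
proof (induction k arbitrary: U V N N')
  case (Suc k)
  { case (1 U V)
    then show ?case
    proof (cases rule: CEq_cases)
      case (unresolved H G)
      then have "HCon H \<in> UV \<Delta>" "HCon G \<in> UV \<Delta>" by (simp_all add: c_unresolved_def)
      then show ?thesis
        using unresolved inst_CMeta[OF substitution_mgu] sub_mgu(1) norm_c_unresolved by metis
    next
      case (resolved c Ns Ns')
      have "map (inst_rtm \<Delta> mgu k) Ns = map (inst_rtm \<Delta> mgu k) Ns'"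
        using CEq_Con(2)[OF resolved(1)] Suc(2)
        by (auto simp: list_all2_conv_all_nth intro!: nth_equalityI)
      then show ?thesis using resolved by (simp add: inst_Con)
    qed }
  note c = this
  { case (2 N N')
    then show ?case
    proof (cases rule: REq_cases)
      case (unresolved H G)
      then have "HRec H \<in> UV \<Delta>" "HRec G \<in> UV \<Delta>" by (simp_all add: r_unresolved_def)
      then show ?thesis
        using unresolved inst_RMeta[OF substitution_mgu] sub_mgu(2) step_r_simps(3) by metis
    next
      case (resolved r s)
      then obtain U V where "Def r U \<in> \<Delta>" "Def s V \<in> \<Delta>"
        using rconsts_REq[OF ctx resolved(1)] by (auto simp: defined_def)
      then show ?thesis
        using resolved c[OF REq_RConst[OF resolved(1)]] inst_RConst[OF ctx] by metis
    qed }
qed auto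

lemma unifier_mgu: "unifier ar \<Delta> mgu"
  unfolding unifier_iff
  using no_contra substitution_mgu subst_dom_shaped mgu_equations_hold by blast

text \<open>The two sides live in different contexts, whose bodies for the constants of \<Delta>
  differ by \<open>norm_c\<close>. At a metavariable the replacement follows equations of \<Delta>,
  and these hold under the unifier \<Gamma>.\<close>

lemma inst_norm:
  assumes "unifier ar \<Delta> \<Gamma>"
  shows "rconsts_ctm U \<subseteq> defined \<Delta> \<Longrightarrow> uv_ctm U \<subseteq> UV \<Delta> \<Longrightarrow>
      inst_ctm mgu \<Gamma> k (norm_c U) = inst_ctm \<Delta> \<Gamma> k U"
    and "rconsts_rtm N \<subseteq> defined \<Delta> \<Longrightarrow> uv_rtm N \<subseteq> UV \<Delta> \<Longrightarrow>
      inst_rtm mgu \<Gamma> k (step_r N) = inst_rtm \<Delta> \<Gamma> k N"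
proof (induction k arbitrary: U N)
  have sub: "substitution ar \<Gamma>"
    and ceq: "\<And>U V k. CEq U V \<in> \<Delta> \<Longrightarrow> inst_ctm \<Delta> \<Gamma> k U = inst_ctm \<Delta> \<Gamma> k V"
    and req: "\<And>N N' k. REq N N' \<in> \<Delta> \<Longrightarrow> inst_rtm \<Delta> \<Gamma> k N = inst_rtm \<Delta> \<Gamma> k N'"
    using assms unfolding unifier_iff by blast+
  have mgu_ctx: "unif_ctx ar mgu" using substitution_mgu by (simp add: substitution_def)
  case (Suc k)
  \<comment> \<open>The constructor case is separated because it is needed again for the resolution
    of a metavariable at depth \<open>Suc k\<close>, where the induction hypothesis does not
    apply.\<close>
  have inst_norm_Con: "inst_ctm mgu \<Gamma> (Suc k) (norm_c (Con c Ns)) = inst_ctm \<Delta> \<Gamma> (Suc k) (Con c Ns)"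
    if "rconsts_ctm (Con c Ns) \<subseteq> defined \<Delta>" "uv_ctm (Con c Ns) \<subseteq> UV \<Delta>" for c Ns
  proof -
    have "inst_rtm mgu \<Gamma> k (step_r N) = inst_rtm \<Delta> \<Gamma> k N" if "N \<in> set Ns" for N
      using that \<open>rconsts_ctm (Con c Ns) \<subseteq> defined \<Delta>\<close> \<open>uv_ctm (Con c Ns) \<subseteq> UV \<Delta>\<close>
      by (intro Suc(2)) auto
    then show ?thesis using norm_c_Con[OF that(2)] by (simp add: inst_Con)
  qed
  { case (1 U)
    show ?case
    proof (cases U)
      case (Con c Ns)
      then show ?thesis using inst_norm_Con 1 by blast
    next
      case (CMeta H)
      then have "HCon H \<in> UV \<Delta>" using 1 by simp
      then show ?thesis
      proof (cases rule: cmeta_cases)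
        case 1
        then obtain c Ns where e: "CEq (CMeta H) (Con c Ns) \<in> \<Delta>"
          "norm_c (CMeta H) = norm_c (Con c Ns)"
          using norm_c_cres by metis
        then show ?thesis
          using CMeta inst_norm_Con[OF rconsts_CEq(2)[OF ctx e(1)]] UV_CEq[OF e(1)] ceq[OF e(1)] by simp
      next
        case 2
        \<comment> \<open>The invariant maps a metavariable to its expansion under \<Gamma>; equated
          metavariables have the same one because \<Gamma> is a unifier.\<close>
        have "inst_ctm \<Delta> \<Gamma> (Suc k) (CMeta H) = inst_ctm \<Delta> \<Gamma> (Suc k) (CMeta (crep H))"
          by (rule c_equiv_invariant[OF crep(1)[OF 2]]) (rule ceq)
        \<comment> \<open>By \<open>inst_CMeta\<close> the expansion of the representative is the
          same whether the first context is \<open>mgu\<close> or \<Delta>.\<close>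
        then show ?thesis
          using CMeta norm_c_unresolved[OF 2] by (simp add: inst_CMeta[OF sub] del: sub_ctm.simps)
      qed
    qed }
  note c = this
  \<comment> \<open>Stated separately since a resolved recursive metavariable also reduces to a
    constant at this same depth.\<close>
  have inst_norm_RConst: "inst_rtm mgu \<Gamma> (Suc k) (RConst r) = inst_rtm \<Delta> \<Gamma> (Suc k) (RConst r)"
    if "r \<in> defined \<Delta>" for r
  proof -
    obtain U where U: "Def r U \<in> \<Delta>" using \<open>r \<in> defined \<Delta>\<close> by (auto simp: defined_def)
    then have "Def r (norm_c U) \<in> mgu" by auto
    then show ?thesis
      using c[OF rconsts_Def[OF ctx U] UV_Def[OF U]] inst_RConst[OF ctx U] inst_RConst[OF mgu_ctx]
      by metis
  qed
  { case (2 N)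
    show ?case
    proof (cases N)
      case (RConst r)
      then show ?thesis using inst_norm_RConst 2 by simp
    next
      case (RMeta H)
      then have "HRec H \<in> UV \<Delta>" using 2 by simp
      then show ?thesis
      proof (cases rule: rmeta_cases)
        case 1
        then obtain r where e: "rres H = RConst r" "REq (RMeta H) (RConst r) \<in> \<Delta>"
          using rres by blast
        then show ?thesis
          using 1 RMeta inst_norm_RConst rconsts_REq(2)[OF ctx e(2)] req[OF e(2)] by simp
      next
        case 2
        have "inst_rtm \<Delta> \<Gamma> (Suc k) (RMeta H) = inst_rtm \<Delta> \<Gamma> (Suc k) (RMeta (rrep H))"
          by (rule r_equiv_invariant[OF rrep(1)[OF 2]]) (rule req)
        then show ?thesis
          using RMeta 2 by (simp add: inst_RMeta[OF sub] del: sub_rtm.simps)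
      qed
    qed }
qed auto

lemma more_general_mgu:
  assumes "unifier ar \<Delta> \<Gamma>"
  shows "more_general ar mgu \<Gamma>"
proof -
  have sub: "substitution ar \<Gamma>" and dom: "subst_dom \<Gamma> = UV \<Delta>"
    using assms by (simp_all add: unifier_def)
  have "subst_eq (subst_comp_apart mgu \<Gamma>) \<Gamma>"
  proof (rule subst_eq_comp_apartI[OF substitution_mgu sub])
    fix H k
    show "inst_ctm mgu \<Gamma> k (sub_ctm mgu (CMeta H)) = exp_ctm \<Gamma> k (sub_ctm \<Gamma> (CMeta H))"
      if "HCon H \<in> subst_dom mgu"
      using that inst_norm(1)[OF assms, of "CMeta H" k] inst_CMeta[OF sub, of \<Delta> k H]
        sub_mgu(1)[of H] by (simp add: subst_dom_shaped del: sub_ctm.simps)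
    show "inst_rtm mgu \<Gamma> k (sub_rtm mgu (RMeta H)) = exp_rtm \<Gamma> k (sub_rtm \<Gamma> (RMeta H))"
      if "HRec H \<in> subst_dom mgu"
      using that inst_norm(2)[OF assms, of "RMeta H" k] inst_RMeta[OF sub, of \<Delta> k H]
        sub_mgu(2)[of H] by (simp add: subst_dom_shaped del: sub_rtm.simps)
  qed (simp add: dom subst_dom_shaped)
  then show ?thesis using sub unfolding more_general_def by blast
qed

end

theorem theorem2p7:
  fixes ar :: "'c \<Rightarrow> nat"
    and \<Delta> :: "('c, 'h, 'r) ctx"
    and cres :: "'h \<Rightarrow> ('c, 'h, 'r) ctm"
    and rres :: "'h \<Rightarrow> ('h, 'r) rtm"
    and crep rrep :: "'h \<Rightarrow> 'h"
  assumes "unif_ctx ar \<Delta>"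
    and "saturated \<Delta>"
    and "Contra \<notin> \<Delta>"
    and "valid_choice \<Delta> cres rres crep rrep"
  shows "unifier ar \<Delta> (unif \<Delta> cres rres crep rrep) \<and>
    most_general_unifier ar \<Delta> (unif \<Delta> cres rres crep rrep)"
proof -
  interpret unif_choice ar \<Delta> cres rres crep rrep
    using assms by unfold_locales
  show ?thesis
    unfolding unif_eq most_general_unifier_def using unifier_mgu more_general_mgu by blast
qed

end
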